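(* Let $m\ge 1$, $k\ge 1$ and $d\ge 3$ be integers, and let $D_1,\dots,D_m$ be integers with $D_i\ge d$ for all $1\le i\le m$; put $n=D_1+\cdots+D_m$ and assume $2^k\neq m-1$. Consider a deck of $n$ cards with $D_i$ cards of type $i$ ($1\le i\le m$), initially sorted with the $1$'s on top, then the $2$'s, and so on down to the $m$'s on the bottom. Then the separation distance after $k$ riffle shuffles ($2$-shuffles) is $$1-(1+\eta)\,\frac{2^{k(m-1)}}{(n+1)\cdots(n+m-1)}\sum_{j=0}^{m-1}(-1)^j\binom{m-1}{j}\Big(1-\frac{j}{2^k}\Big)^{n+m-1},$$ where $\eta$ is a real number satisfying $$|\eta|\le\Big(1+\frac{n^2}{3(d-2)(2^k-m+1)^2}\Big)^{m-1}-1 .$$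
   Context: Riffle shuffle ($2$-shuffle; Gilbert-Shannon-Reeds model) of $n$ cards: the deck is cut into a top packet of $A$ cards and a bottom packet of $n-A$ cards with probability $2^{-n}\binom{n}{A}$, $0\le A\le n$ (empty packets allowed); the packets are then riffled together by dropping cards one at a time from the bottoms of the packets, the next card coming from a given packet with probability proportional to its current size (equivalently, all interleavings preserving the order within each packet are equally likely). Successive shuffles are independent. Cards of the same type are indistinguishable, so a deck configuration is a word $w$ containing $D_i$ letters $i$ for each $i$. If $Q(w)$ is the probability that the deck is in configuration $w$ after the $k$ shuffles, the separation distance is $\max_w\big(1-Q(w)/U\big)$, where $U=D_1!\cdots D_m!/n!$ is the uniform probability and the maximum is over all configurations. The empty product $(n+1)\cdots(n+m-1)$ for $m=1$ equals $1$. *)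

theory Defs
  imports "HOL-Probability.Probability"
begin

text \<open>A deck is a list whose head is the top card. Cards are represented by their types only:
  the dynamics below acts on positions and never compares cards, so indistinguishable cards may
  be represented by equal list entries.\<close>

text \<open>\<open>riffle xs ys\<close> is the law of the deck obtained by dropping cards from the bottoms of the packets
  \<open>xs\<close> and \<open>ys\<close>. The first card dropped ends up at the bottom of the resulting pile.\<close>

function riffle :: "'a list \<Rightarrow> 'a list \<Rightarrow> 'a list pmf" where
  "riffle xs ys =
     (if xs = [] then return_pmf ys
      else if ys = [] then return_pmf xs
      else bind_pmf (bernoulli_pmf (real (length xs) / real (length xs + length ys)))
        (\<lambda>b. if b then map_pmf (\<lambda>zs. zs @ [last xs]) (riffle (butlast xs) ys)
             else map_pmf (\<lambda>zs. zs @ [last ys]) (riffle xs (butlast ys))))"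
  by pat_completeness auto
termination
  by (relation "Wellfounded.measure (\<lambda>(xs, ys). length xs + length ys)") auto

declare riffle.simps [simp del]

definition riffle_shuffle :: "'a list \<Rightarrow> 'a list pmf" where
  "riffle_shuffle deck =
     bind_pmf (binomial_pmf (length deck) (1/2)) (\<lambda>A. riffle (take A deck) (drop A deck))"

primrec riffle_shuffles :: "nat \<Rightarrow> 'a list \<Rightarrow> 'a list pmf" where
  "riffle_shuffles 0 deck = return_pmf deck"
| "riffle_shuffles (Suc k) deck = bind_pmf (riffle_shuffles k deck) riffle_shuffle"

definition sorted_deck :: "nat \<Rightarrow> (nat \<Rightarrow> nat) \<Rightarrow> nat list" where
  "sorted_deck m D = concat (map (\<lambda>i. replicate (D i) i) [1..<m+1])"

definition configurations :: "nat \<Rightarrow> (nat \<Rightarrow> nat) \<Rightarrow> nat list set" where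
  "configurations m D = {w. set w \<subseteq> {1..m} \<and> (\<forall>i\<in>{1..m}. count_list w i = D i)}"

definition uniform_prob :: "nat \<Rightarrow> (nat \<Rightarrow> nat) \<Rightarrow> real" where
  "uniform_prob m D = (\<Prod>i=1..m. fact (D i)) / fact (\<Sum>i=1..m. D i)"

definition separation_distance :: "nat \<Rightarrow> (nat \<Rightarrow> nat) \<Rightarrow> nat \<Rightarrow> real" where
  "separation_distance m D k =
     Max ((\<lambda>w. 1 - pmf (riffle_shuffles k (sorted_deck m D)) w / uniform_prob m D)
            ` configurations m D)"

text \<open>The maximum above ranges over a finite nonempty set.\<close>

lemma length_configuration:
  assumes "w \<in> configurations m D"
  shows "length w = (\<Sum>i=1..m. D i)"
proof -
  have "length w = (\<Sum>i\<in>{1..m}. count_list w i)"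
    using assms sum_count_set[of w "{1..m}"] by (simp add: configurations_def)
  then show ?thesis
    using assms by (simp add: configurations_def)
qed

lemma finite_configurations: "finite (configurations m D)"
proof (rule finite_subset)
  show "configurations m D \<subseteq> {w. set w \<subseteq> {1..m} \<and> length w = (\<Sum>i=1..m. D i)}"
    using length_configuration by (auto simp: configurations_def)
  show "finite {w. set w \<subseteq> {1..m} \<and> length w = (\<Sum>i=1..m. D i)}"
    by (rule finite_lists_length_eq) simp
qed

lemma count_list_replicate_eq: "count_list (replicate c x) y = (if x = y then c else 0)"
  by (induction c) auto

lemma count_list_sorted_deck:
  "count_list (sorted_deck m D) i = (if i \<in> {1..m} then D i else 0)"
  unfolding sorted_deck_def by (induction m) (auto simp: count_list_replicate_eq)

lemma sorted_deck_in_configurations: "sorted_deck m D \<in> configurations m D"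
  unfolding configurations_def
  by (auto simp: count_list_sorted_deck) (auto simp: sorted_deck_def split: if_splits)

end

theory Submission
  imports Defs
begin

text \<open>
  Read backwards, a riffle shuffle labels each card of the final deck independently with \<open>0\<close> or
  \<open>1\<close> and then sorts the deck stably by label. The labels of \<open>k\<close> successive shuffles are the binary
  digits of one label below \<open>a = 2 ^ k\<close>, because sorting digit by digit is radix sort. Hence the
  probability of a configuration \<open>w\<close> is the number of labellings of \<open>w\<close> whose stable sort is the
  sorted deck, divided by \<open>a ^ n\<close> (\<open>pmf_riffle_shuffles\<close>). A labelling that gives strictly smaller
  labels to smaller types sorts every \<open>w\<close>; for the reversed sorted deck there are no other good
  labellings, since ties would keep the wrong order. So the reversed deck is the least likely
  configuration, and the separation distance is read off from the number of separated labellings,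
  which depends only on the \<open>D\<^sub>i\<close> and \<open>a\<close> and is given by the recursion \<open>sep_count\<close>
  (\<open>separation_distance_eq\<close>).

  It remains to estimate \<open>sep_count\<close>. It is an iterated discrete convolution of the weights
  \<open>k ^ D - (k - 1) ^ D\<close>, which are the integrals of \<open>D * (k - s) ^ (D - 1)\<close> over \<open>0 \<le> s \<le> 1\<close>. For fixed
  \<open>s\<close> one has to sum the function \<open>F x = x ^ (D - 1) * (T - x) ^ q\<close> over a grid of step one, and
  the trapezoid rule compares this sum with the Beta integral of \<open>F\<close>. Here \<open>F'' = P - N\<close> where \<open>P\<close>
  and \<open>N\<close> are nonnegative with equal integrals, and the kernel of the trapezoid rule lies between
  \<open>0\<close> and \<open>1/8\<close>, so the error is at most an eighth of the integral of \<open>N\<close>. That integral is again a sum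
  of Beta integrals; relative to the main term it is at most of order \<open>n\<^sup>2 / ((d - 2) * T\<^sup>2)\<close>
  (\<open>bump_sum_error\<close>).

  The integration over \<open>s\<close> is the operator \<open>avg\<close>, the mean over a unit interval. Induction over the
  types shows that, up to the factor \<open>D\<^sub>1! * ... * D\<^sub>m!\<close>, the number of separated labellings is the
  \<open>(m - 1)\<close>-fold mean of \<open>T ^ n / n!\<close>, with an error bounded by a binomial sum of means of lower
  powers \<open>T ^ (n - 2 * i)\<close> (\<open>sep_count_error\<close>). These means only see \<open>T \<ge> a - m + 1\<close>, where each loss of two
  powers costs at most a factor \<open>n\<^sup>2 / (a - m + 1)\<^sup>2\<close>, and the binomial sum becomes the power in the
  bound on \<open>\<eta>\<close> (\<open>sep_count_relative_error\<close>). The mean of the leading term is an alternating binomial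
  sum by the fundamental theorem of calculus (\<open>avg_pow_tpow\<close>), which is the main term claimed. All
  this needs \<open>m \<le> a\<close>. If \<open>a < m\<close>, there are no separated labellings, the separation distance is \<open>1\<close>,
  and \<open>\<eta> = -1\<close> is admissible because \<open>n \<ge> d * m\<close> makes the bound at least \<open>1\<close>.
\<close>

section \<open>One riffle shuffle as a random labelling\<close>

definition labellings :: "nat \<Rightarrow> 'a list \<Rightarrow> (nat \<times> 'a) list set" where
  "labellings a w = {z. map snd z = w \<and> fst ` set z \<subseteq> {..<a}}"

definition unshuffle :: "(nat \<times> 'a) list \<Rightarrow> 'a list" where
  "unshuffle z = map snd (sort_key fst z)"

lemma length_unshuffle [simp]: "length (unshuffle z) = length z"
  by (simp add: unshuffle_def)

lemma labellings_Nil [simp]: "labellings a [] = {[]}"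
  by (auto simp: labellings_def)

lemma length_labellings: "z \<in> labellings a w \<Longrightarrow> length z = length w"
  by (auto simp: labellings_def)

lemma labellings_Cons: "labellings a (x # w) = (\<lambda>(i, z). (i, x) # z) ` ({..<a} \<times> labellings a w)"
  by (force simp: labellings_def map_eq_Cons_conv)

lemma labellings_finite_card: "finite (labellings a w) \<and> card (labellings a w) = a ^ length w"
proof (induction w)
  case (Cons x w)
  have "inj_on (\<lambda>(i, z). (i, x) # z) ({..<a} \<times> labellings a w)"
    by (auto simp: inj_on_def)
  with Cons show ?case
    by (simp add: labellings_Cons card_image card_cartesian_product)
qed simp

lemma finite_labellings [simp]: "finite (labellings a w)"
  and card_labellings: "card (labellings a w) = a ^ length w"
  using labellings_finite_card by auto

lemma labellings_snoc: "z @ [(i, x)] \<in> labellings a (w @ [c]) \<longleftrightarrow> z \<in> labellings a w \<and> x = c \<and> i < a"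
  by (auto simp: labellings_def)

lemma labellings_snoc_cases:
  assumes "z \<in> labellings a (w @ [c])"
  obtains i z' where "z = z' @ [(i, c)]" "z' \<in> labellings a w" "i < a"
proof -
  have "z \<noteq> []" using assms by (auto simp: labellings_def)
  then obtain z' p where z: "z = z' @ [p]" by (metis rev_exhaust)
  obtain i x where "p = (i, x)" by force
  with that[of z' i] assms show ?thesis unfolding z by (auto simp: labellings_snoc)
qed

text \<open>The two packets out of which a labelled deck was riffled: label \<open>0\<close> marks the cards of the top
  packet, label \<open>1\<close> those of the bottom packet.\<close>

definition packets :: "(nat \<times> 'a) list \<Rightarrow> 'a list \<times> 'a list" where
  "packets z = (map snd (filter (\<lambda>p. fst p = 0) z), map snd (filter (\<lambda>p. fst p = 1) z))"

definition interleavings :: "'a list \<Rightarrow> 'a list \<Rightarrow> 'a list \<Rightarrow> (nat \<times> 'a) list set" where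
  "interleavings xs ys w = {z \<in> labellings 2 w. packets z = (xs, ys)}"

lemma finite_interleavings [simp]: "finite (interleavings xs ys w)"
  by (simp add: interleavings_def)

text \<open>The recursion of \<open>riffle\<close>, in counting form: the bottom card of the result is the bottom card of one
  of the two packets.\<close>

lemma card_interleavings_snoc:
  "card (interleavings xs ys (w @ [c]))
    = (if xs \<noteq> [] \<and> last xs = c then card (interleavings (butlast xs) ys w) else 0)
    + (if ys \<noteq> [] \<and> last ys = c then card (interleavings xs (butlast ys) w) else 0)"
proof -
  define A where "A = (if xs \<noteq> [] \<and> last xs = c then (\<lambda>z. z @ [(0::nat, c)]) ` interleavings (butlast xs) ys w else {})"
  define B where "B = (if ys \<noteq> [] \<and> last ys = c then (\<lambda>z. z @ [(1::nat, c)]) ` interleavings xs (butlast ys) w else {})"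
  have snoc: "us @ [c] = vs \<longleftrightarrow> vs \<noteq> [] \<and> last vs = c \<and> us = butlast vs" for us vs
    by (metis append_butlast_last_id butlast_snoc last_snoc snoc_eq_iff_butlast)
  have snoc': "vs \<noteq> [] \<Longrightarrow> last vs = d \<Longrightarrow> butlast vs @ [d] = vs" for vs and d :: 'a
    by auto
  have "interleavings xs ys (w @ [c]) = A \<union> B"
  proof (intro equalityI subsetI)
    fix z assume z: "z \<in> interleavings xs ys (w @ [c])"
    then obtain i z' where z': "z = z' @ [(i, c)]" "z' \<in> labellings 2 w" "i < 2"
      by (auto simp: interleavings_def elim: labellings_snoc_cases)
    from z'(3) have "i = 0 \<or> i = 1" by auto
    with z z' show "z \<in> A \<union> B"
      by (auto simp: A_def B_def interleavings_def packets_def snoc)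
  next
    fix z assume "z \<in> A \<union> B"
    then show "z \<in> interleavings xs ys (w @ [c])"
      by (auto simp: A_def B_def interleavings_def packets_def labellings_snoc snoc' split: if_splits)
  qed
  moreover have "A \<inter> B = {}" "finite A" "finite B"
    by (auto simp: A_def B_def)
  ultimately show ?thesis
    by (simp add: card_Un_disjoint A_def B_def card_image inj_on_def)
qed

lemma pmf_map_snoc:
  "pmf (map_pmf (\<lambda>zs. zs @ [a]) p) (w @ [c]) = (if a = c then pmf p w else 0)"
proof (cases "a = c")
  case True
  have "inj (\<lambda>zs. zs @ [a])" by (auto simp: inj_def)
  from pmf_map_inj'[OF this, of p w] True show ?thesis by simp
next
  case False
  then have "w @ [c] \<notin> set_pmf (map_pmf (\<lambda>zs. zs @ [a]) p)" by auto
  then have "pmf (map_pmf (\<lambda>zs. zs @ [a]) p) (w @ [c]) = 0" unfolding pmf_eq_0_set_pmf .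
  with False show ?thesis by simp
qed

text \<open>Dropping cards with probabilities proportional to the packet sizes makes all interleavings equally
  likely. In the induction this is the identity \<open>i / (i + j) * (i + j choose i) = (i + j - 1 choose i - 1)\<close>
  for packets of sizes \<open>i\<close> and \<open>j\<close>, together with its mirror image. The bottom card is dropped first, hence the induction from the end of \<open>w\<close>.\<close>

lemma pmf_riffle:
  "pmf (riffle xs ys) w * real ((length xs + length ys) choose length xs) = real (card (interleavings xs ys w))"
proof (induction w arbitrary: xs ys rule: rev_induct)
  case Nil
  have I: "interleavings xs ys [] = (if xs = [] \<and> ys = [] then {[]} else {})"
    by (auto simp: interleavings_def packets_def)
  show ?case
  proof (cases "xs = [] \<or> ys = []")
    case True
    then show ?thesis unfolding I by (auto simp: riffle.simps)
  next
    case False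
    then have "[] \<notin> set_pmf (riffle xs ys)"
      by (subst riffle.simps) (auto split: if_splits)
    then show ?thesis unfolding I using False by (simp add: set_pmf_iff)
  qed
next
  case (snoc c w)
  note rec = card_interleavings_snoc[of xs ys w c]
  consider "xs = []" "ys = []" | "xs = []" "ys \<noteq> []" | "xs \<noteq> []" "ys = []" | "xs \<noteq> []" "ys \<noteq> []" by blast
  then show ?case
  proof cases
    case 1
    then show ?thesis unfolding rec by (simp add: riffle.simps)
  next
    case 2
    have "real (card (interleavings [] (butlast ys) w)) = (if butlast ys = w then 1 else 0)"
      using snoc[of "[]" "butlast ys"] by (auto simp: riffle.simps indicator_def split: if_splits)
    moreover have "ys = w @ [c] \<longleftrightarrow> last ys = c \<and> butlast ys = w"
      using 2 by (metis append_butlast_last_id butlast_snoc last_snoc)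
    ultimately show ?thesis unfolding rec using 2 by (simp add: riffle.simps)
  next
    case 3
    have "real (card (interleavings (butlast xs) [] w)) = (if butlast xs = w then 1 else 0)"
      using snoc[of "butlast xs" "[]"] by (auto simp: riffle.simps indicator_def split: if_splits)
    moreover have "xs = w @ [c] \<longleftrightarrow> last xs = c \<and> butlast xs = w"
      using 3 by (metis append_butlast_last_id butlast_snoc last_snoc)
    ultimately show ?thesis unfolding rec using 3 by (simp add: riffle.simps)
  next
    case 4
    obtain i j where ij: "length xs = Suc i" "length ys = Suc j"
      using 4 by (metis length_0_conv not0_implies_Suc)
    define p where "p = real (length xs) / real (length xs + length ys)"
    have p01: "0 \<le> p" "p \<le> 1" by (auto simp: p_def divide_simps)
    have p: "p * real ((Suc i + Suc j) choose Suc i) = real ((i + Suc j) choose i)"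
      using Suc_times_binomial[of i "i + Suc j"] unfolding p_def ij
      by (simp add: field_simps del: binomial_Suc_Suc flip: of_nat_mult of_nat_Suc of_nat_add)
    have q: "(1 - p) * real ((Suc i + Suc j) choose Suc i) = real ((Suc i + j) choose Suc i)"
      using p by (simp add: left_diff_distrib)
    have "riffle xs ys = bind_pmf (bernoulli_pmf p)
        (\<lambda>b. if b then map_pmf (\<lambda>zs. zs @ [last xs]) (riffle (butlast xs) ys)
             else map_pmf (\<lambda>zs. zs @ [last ys]) (riffle xs (butlast ys)))"
      using 4 unfolding p_def by (subst riffle.simps) simp
    then have "pmf (riffle xs ys) (w @ [c])
       = p * (if last xs = c then pmf (riffle (butlast xs) ys) w else 0)
       + (1 - p) * (if last ys = c then pmf (riffle xs (butlast ys)) w else 0)"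
      using p01 by (simp add: pmf_bind pmf_map_snoc mult.commute)
    moreover have "(p * u + (1 - p) * v) * C = u * (p * C) + v * ((1 - p) * C)" for u v C :: real
      by (simp add: algebra_simps)
    ultimately have "pmf (riffle xs ys) (w @ [c]) * real ((Suc i + Suc j) choose Suc i)
       = (if last xs = c then pmf (riffle (butlast xs) ys) w else 0) * real ((i + Suc j) choose i)
       + (if last ys = c then pmf (riffle xs (butlast ys)) w else 0) * real ((Suc i + j) choose Suc i)"
      by (simp only: p q)
    then show ?thesis
      unfolding rec ij using 4 snoc[of "butlast xs" ys] snoc[of xs "butlast ys"] ij by (simp del: binomial_Suc_Suc)
  qed
qed

lemma sort_key_binary_label:
  assumes "fst ` set z \<subseteq> {..<2::nat}"
  shows "sort_key fst z = filter (\<lambda>p. fst p = 0) z @ filter (\<lambda>p. fst p = 1) z"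
proof (rule properties_for_sort_key)
  have "\<forall>p\<in>set z. fst p = 0 \<or> fst p = 1" using assms by (auto simp: less_2_cases_iff)
  then have "filter (\<lambda>p. fst p = 1) z = filter (\<lambda>p. \<not> fst p = 0) z"
    by (intro filter_cong) auto
  then show "mset (filter (\<lambda>p. fst p = 0) z @ filter (\<lambda>p. fst p = 1) z) = mset z"
    by (simp only: mset_append mset_filter multiset_partition[symmetric])
next
  fix k assume "k \<in> set (filter (\<lambda>p. fst p = 0) z @ filter (\<lambda>p. fst p = 1) z)"
  then have "fst k = 0 \<or> fst k = 1" by auto
  moreover have "(fst x = 0 \<and> Suc 0 = fst x) = False" "(fst x = 1 \<and> 0 = fst x) = False" for x :: "nat \<times> 'a" by auto
  ultimately show "filter (\<lambda>x. fst k = fst x) (filter (\<lambda>p. fst p = 0) z @ filter (\<lambda>p. fst p = 1) z) = filter (\<lambda>x. fst k = fst x) z"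
    by (auto intro!: filter_cong)
next
  show "sorted (map fst (filter (\<lambda>p. fst p = 0) z @ filter (\<lambda>p. fst p = 1) z))"
    using sorted_map_same[of fst "\<lambda>_. 0" z] sorted_map_same[of fst "\<lambda>_. 1" z]
    by (auto simp: sorted_append)
qed

lemma unshuffle_packets:
  assumes "z \<in> labellings 2 w"
  shows "unshuffle z = fst (packets z) @ snd (packets z)"
  using assms by (simp add: labellings_def unshuffle_def packets_def sort_key_binary_label)

text \<open>The binomial weight of the cut cancels the number of interleavings, so that all \<open>0\<close>-\<open>1\<close> labellings
  of the final deck have the same weight.\<close>

lemma pmf_riffle_shuffle:
  "pmf (riffle_shuffle deck) w = real (card {z \<in> labellings 2 w. unshuffle z = deck}) / 2 ^ length deck"
proof -
  let ?n = "length deck"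
  have "pmf (riffle_shuffle deck) w
     = (\<Sum>A\<le>?n. pmf (riffle (take A deck) (drop A deck)) w * pmf (binomial_pmf ?n (1/2)) A)"
    unfolding riffle_shuffle_def pmf_bind
    by (rule integral_measure_pmf_real) (auto simp: set_pmf_binomial_eq split: if_splits)
  also have "\<dots> = (\<Sum>A\<le>?n. real (card (interleavings (take A deck) (drop A deck) w)) / 2 ^ ?n)"
  proof (rule sum.cong)
    fix A assume A: "A \<in> {..?n}"
    have "pmf (binomial_pmf ?n (1/2)) A = real (?n choose A) / 2 ^ ?n"
      using A by (simp add: power_divide flip: power_add)
    then show "pmf (riffle (take A deck) (drop A deck)) w * pmf (binomial_pmf ?n (1/2)) A
       = real (card (interleavings (take A deck) (drop A deck) w)) / 2 ^ ?n"
      using pmf_riffle[of "take A deck" "drop A deck" w] A by (simp add: min_absorb2)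
  qed simp
  also have "\<dots> = real (\<Sum>A\<le>?n. card (interleavings (take A deck) (drop A deck) w)) / 2 ^ ?n"
    by (simp add: sum_divide_distrib)
  also have "(\<Sum>A\<le>?n. card (interleavings (take A deck) (drop A deck) w))
     = card (\<Union>A\<le>?n. interleavings (take A deck) (drop A deck) w)"
  proof (rule card_UN_disjoint[symmetric])
    show "\<forall>i\<in>{..?n}. \<forall>j\<in>{..?n}. i \<noteq> j \<longrightarrow>
       interleavings (take i deck) (drop i deck) w \<inter> interleavings (take j deck) (drop j deck) w = {}"
    proof (intro ballI impI equals0I)
      fix i j z
      assume ij: "i \<in> {..?n}" "j \<in> {..?n}" "i \<noteq> j"
        and "z \<in> interleavings (take i deck) (drop i deck) w \<inter> interleavings (take j deck) (drop j deck) w"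
      then have "packets z = (take i deck, drop i deck)" "packets z = (take j deck, drop j deck)"
        unfolding interleavings_def by blast+
      then have "take i deck = take j deck" by simp
      from arg_cong[OF this, of length] ij show False by simp
    qed
  qed auto
  also have "(\<Union>A\<le>?n. interleavings (take A deck) (drop A deck) w) = {z \<in> labellings 2 w. unshuffle z = deck}"
  proof (intro equalityI subsetI)
    fix z assume "z \<in> (\<Union>A\<le>?n. interleavings (take A deck) (drop A deck) w)"
    then obtain A where z: "z \<in> labellings 2 w" "packets z = (take A deck, drop A deck)"
      by (auto simp: interleavings_def)
    then show "z \<in> {z \<in> labellings 2 w. unshuffle z = deck}"
      by (simp add: unshuffle_packets)
  next
    fix z assume "z \<in> {z \<in> labellings 2 w. unshuffle z = deck}"
    then have z: "z \<in> labellings 2 w" and deck: "deck = fst (packets z) @ snd (packets z)"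
      by (auto simp: unshuffle_packets)
    have "z \<in> interleavings (take (length (fst (packets z))) deck) (drop (length (fst (packets z))) deck) w"
      "length (fst (packets z)) \<le> ?n"
      using z by (simp_all add: interleavings_def deck)
    then show "z \<in> (\<Union>A\<le>?n. interleavings (take A deck) (drop A deck) w)" by blast
  qed
  finally show ?thesis .
qed

section \<open>Iterated shuffles and radix sort\<close>

lemma map_insort_key:
  assumes "\<And>x y. f x \<le> f y \<longleftrightarrow> g (h x) \<le> g (h y)"
  shows "map h (insort_key f x xs) = insort_key g (h x) (map h xs)"
  using assms by (induction xs) auto

lemma map_sort_key:
  assumes "\<And>x y. f x \<le> f y \<longleftrightarrow> g (h x) \<le> g (h y)"
  shows "map h (sort_key f xs) = sort_key g (map h xs)"
  by (induction xs) (auto simp: map_insort_key[of f g h, OF assms])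

lemma sort_key_cong_order:
  assumes "\<And>x y. x \<in> set xs \<Longrightarrow> y \<in> set xs \<Longrightarrow> f x \<le> f y \<longleftrightarrow> g x \<le> g y"
  shows "sort_key f xs = sort_key g xs"
  using assms
proof (induction xs)
  case (Cons x xs)
  have "insort_key f x ys = insort_key g x ys" if "set ys \<subseteq> set xs" for ys
    using that Cons.prems by (induction ys) auto
  with Cons show ?case by simp
qed simp

text \<open>Radix sort: a stable sort by the higher digit keeps the order by the lower digit among ties.\<close>

lemma sort_key_radix:
  fixes f :: "'b \<Rightarrow> nat"
  shows "sort_key (\<lambda>x. f x div 2) (sort_key (\<lambda>x. f x mod 2) xs) = sort_key f xs"
proof (rule properties_for_sort_key)
  show "mset (sort_key f xs) = mset (sort_key (\<lambda>x. f x mod 2) xs)" by simp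
  have "sorted (map f (sort_key f xs))" by simp
  then show "sorted (map (\<lambda>x. f x div 2) (sort_key f xs))"
    unfolding sorted_map by (rule sorted_wrt_mono_rel[rotated]) (simp add: div_le_mono)
  fix k
  let ?zs = "filter (\<lambda>x. f k div 2 = f x div 2) xs"
  have "sort_key f ?zs = sort_key (\<lambda>x. f x mod 2) ?zs"
  proof (rule sort_key_cong_order)
    fix x y assume "x \<in> set ?zs" "y \<in> set ?zs"
    then have "f x div 2 = f y div 2" by simp
    then show "f x \<le> f y \<longleftrightarrow> f x mod 2 \<le> f y mod 2"
      by (metis add_le_cancel_left mult_div_mod_eq)
  qed
  then show "filter (\<lambda>x. f k div 2 = f x div 2) (sort_key f xs)
     = filter (\<lambda>x. f k div 2 = f x div 2) (sort_key (\<lambda>x. f x mod 2) xs)"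
    by (simp add: filter_sort)
qed

text \<open>The position at which an element is inserted depends only on the keys, so sorting rearranges
  two lists with the same keys by the same permutation. This and the next lemma recover a
  list from its keys and its sorted version.\<close>

lemma insort_key_inject:
  assumes "map g ys = map g ys'" "g x = g x'" "map h (insort_key g x ys) = map h (insort_key g x' ys')"
  shows "h x = h x' \<and> map h ys = map h ys'"
  using assms
proof (induction ys arbitrary: ys')
  case (Cons y ys)
  from Cons.prems(1) obtain y' us where "ys' = y' # us" by (cases ys') auto
  with Cons show ?case by (auto split: if_splits)
qed auto

lemma sort_key_inject:
  assumes "map g z = map g z'" "map h (sort_key g z) = map h (sort_key g z')"
  shows "map h z = map h z'"
  using assms
proof (induction z arbitrary: z')
  case (Cons x xs)
  from Cons.prems(1) obtain x' us where z': "z' = x' # us" by (cases z') auto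
  have "map g (sort_key g xs) = map g (sort_key g us)"
    using Cons.prems(1) by (simp add: z' map_sort_key[of g "\<lambda>x. x" g])
  from insort_key_inject[OF this, of x x' h] Cons show ?case by (simp add: z')
qed simp

text \<open>Splits a label into its last binary digit and the remaining number. The last digit belongs to
  the last shuffle and stays on the final deck; the remaining number travels with its card to the
  position which the card had before that shuffle.\<close>

definition digits :: "(nat \<times> 'a) list \<Rightarrow> (nat \<times> 'a) list \<times> (nat \<times> 'a) list" where
  "digits z = (map (apfst (\<lambda>i. i mod 2)) z, map (apfst (\<lambda>i. i div 2)) (sort_key (\<lambda>p. fst p mod 2) z))"

lemma unshuffle_fst_digits: "unshuffle (fst (digits z)) = map snd (sort_key (\<lambda>p. fst p mod 2) z)"
proof -
  have "sort_key fst (map (apfst (\<lambda>i. i mod 2)) z) = map (apfst (\<lambda>i. i mod 2)) (sort_key (\<lambda>p. fst p mod 2) z)"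
    by (rule map_sort_key[symmetric]) simp
  then show ?thesis by (simp add: unshuffle_def digits_def)
qed

lemma unshuffle_snd_digits: "unshuffle (snd (digits z)) = unshuffle z"
proof -
  have "sort_key fst (map (apfst (\<lambda>i. i div 2)) ys) = map (apfst (\<lambda>i. i div 2)) (sort_key (\<lambda>p. fst p div 2) ys)"
    for ys :: "(nat \<times> 'a) list"
    by (rule map_sort_key[symmetric]) simp
  then show ?thesis by (simp add: unshuffle_def digits_def sort_key_radix[of fst])
qed

text \<open>Injectivity comes from \<open>sort_key_inject\<close>; surjectivity then follows by comparing cardinalities,
  which spares the construction of the inverse.\<close>

lemma bij_betw_digits:
  "bij_betw digits (labellings (2 * a) w) (SIGMA b : labellings 2 w. labellings a (unshuffle b))"
proof -
  let ?T = "SIGMA b : labellings 2 w. labellings a (unshuffle b)"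
  have inj: "inj_on digits (labellings (2 * a) w)"
  proof (rule inj_onI)
    fix z z' :: "(nat \<times> 'a) list"
    assume "digits z = digits z'"
    then have 1: "map (apfst (\<lambda>i. i mod 2)) z = map (apfst (\<lambda>i. i mod 2)) z'"
      and 2: "map (apfst (\<lambda>i. i div 2)) (sort_key (\<lambda>p. fst p mod 2) z) = map (apfst (\<lambda>i. i div 2)) (sort_key (\<lambda>p. fst p mod 2) z')"
      by (simp_all add: digits_def)
    from arg_cong[OF 1, of "map fst"] have "map (\<lambda>p. fst p mod 2) z = map (\<lambda>p. fst p mod 2) z'"
      by (simp add: o_def)
    from sort_key_inject[OF this 2] have 3: "map (apfst (\<lambda>i. i div 2)) z = map (apfst (\<lambda>i. i div 2)) z'" .
    have len: "length z = length z'" using 1 by (metis length_map)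
    show "z = z'"
    proof (rule nth_equalityI[OF len])
      fix i assume i: "i < length z"
      have "apfst (\<lambda>i. i mod 2) (z ! i) = apfst (\<lambda>i. i mod 2) (z' ! i)" "apfst (\<lambda>i. i div 2) (z ! i) = apfst (\<lambda>i. i div 2) (z' ! i)"
        using 1 3 i len by (metis nth_map)+
      then show "z ! i = z' ! i"
        by (cases "z ! i"; cases "z' ! i") (auto, metis div_mult_mod_eq)
    qed
  qed
  moreover have "digits ` labellings (2 * a) w = ?T"
  proof (rule card_subset_eq)
    show "finite ?T" by simp
    show "digits ` labellings (2 * a) w \<subseteq> ?T"
    proof
      fix t assume "t \<in> digits ` labellings (2 * a) w"
      then obtain z where z: "z \<in> labellings (2 * a) w" "t = digits z" by blast
      have "snd (digits z) \<in> labellings a (unshuffle (fst (digits z)))"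
        unfolding unshuffle_fst_digits using z(1) by (auto simp: digits_def labellings_def)
      moreover have "fst (digits z) \<in> labellings 2 w"
        using z(1) by (auto simp: digits_def labellings_def)
      ultimately show "t \<in> ?T" by (simp add: z(2) mem_Times_iff split_beta mem_Sigma_iff[of "fst (digits z)" "snd (digits z)", simplified])
    qed
    have "card ?T = (\<Sum>b\<in>labellings 2 w. a ^ length w)"
      by (subst card_SigmaI) (auto simp: card_labellings length_labellings intro!: sum.cong)
    then show "card (digits ` labellings (2 * a) w) = card ?T"
      by (simp add: card_image[OF inj] card_labellings power_mult_distrib)
  qed
  ultimately show ?thesis by (simp add: bij_betw_def)
qed

text \<open>Conditioning on the deck before the last shuffle yields a sum over pairs of labellings, which
  \<open>digits\<close> turns into a sum over labellings with twice as many labels.\<close>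

lemma pmf_riffle_shuffles:
  "pmf (riffle_shuffles k deck) w
    = real (card {z \<in> labellings (2 ^ k) w. unshuffle z = deck}) / (2 ^ k) ^ length deck"
proof (induction k arbitrary: w)
  case 0
  have "{z \<in> labellings 1 w. unshuffle z = deck} = (if w = deck then {map (\<lambda>x. (0, x)) w} else {})"
  proof -
    have "z \<in> labellings 1 w \<longleftrightarrow> z = map (\<lambda>x. (0, x)) w" for z
    proof
      assume z: "z \<in> labellings 1 w"
      then have "map (\<lambda>x. (0, x)) w = map (\<lambda>p. (0, snd p)) z" by (auto simp: labellings_def)
      also have "\<dots> = map (\<lambda>p. p) z"
        using z by (intro map_cong) (force simp: labellings_def)+
      finally show "z = map (\<lambda>x. (0, x)) w" by simp
    qed (auto simp: labellings_def o_def)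
    moreover have "sort_key fst (map (\<lambda>x. (0::nat, x)) w) = map (\<lambda>x. (0, x)) w"
      by (rule sort_key_id_if_sorted) (simp add: o_def sorted_wrt_true map_replicate_const)
    ultimately show ?thesis by (auto simp: unshuffle_def o_def)
  qed
  then show ?case by auto
next
  case (Suc k)
  let ?V = "unshuffle ` labellings 2 w"
  let ?n = "length deck"
  let ?A = "\<lambda>v. {y \<in> labellings (2 ^ k) v. unshuffle y = deck}"
  let ?B = "\<lambda>v. {b \<in> labellings 2 w. unshuffle b = v}"
  have fin: "finite (?A v)" "finite (?B v)" for v by auto
  have "pmf (riffle_shuffles (Suc k) deck) w
    = (\<Sum>v\<in>?V. pmf (riffle_shuffle v) w * pmf (riffle_shuffles k deck) v)"
    unfolding riffle_shuffles.simps pmf_bind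
  proof (rule integral_measure_pmf_real)
    fix v assume "pmf (riffle_shuffle v) w \<noteq> 0"
    then have "?B v \<noteq> {}" unfolding pmf_riffle_shuffle by (metis card.empty divide_eq_0_iff of_nat_0)
    then show "v \<in> ?V" by auto
  qed simp
  also have "\<dots> = (\<Sum>v\<in>?V. real (card (?B v) * card (?A v)) / (2 ^ Suc k) ^ ?n)"
  proof (rule sum.cong)
    fix v assume "v \<in> ?V"
    show "pmf (riffle_shuffle v) w * pmf (riffle_shuffles k deck) v = real (card (?B v) * card (?A v)) / (2 ^ Suc k) ^ ?n"
    proof (cases "?A v = {}")
      case True
      then show ?thesis unfolding Suc.IH True by simp
    next
      case False
      then have "length v = ?n" by (auto simp: length_labellings)
      then show ?thesis unfolding Suc.IH pmf_riffle_shuffle by (simp add: power_mult_distrib)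
    qed
  qed simp
  also have "\<dots> = real (\<Sum>v\<in>?V. card (?B v) * card (?A v)) / (2 ^ Suc k) ^ ?n"
    by (simp add: sum_divide_distrib)
  also have "(\<Sum>v\<in>?V. card (?B v) * card (?A v)) = (\<Sum>v\<in>?V. \<Sum>b\<in>?B v. card (?A (unshuffle b)))"
    by (intro sum.cong) auto
  also have "\<dots> = (\<Sum>b\<in>labellings 2 w. card (?A (unshuffle b)))"
    by (rule sum.image_gen[symmetric]) simp
  also have "\<dots> = card (SIGMA b : labellings 2 w. ?A (unshuffle b))"
    by (rule card_SigmaI[symmetric]) auto
  also have "\<dots> = card {z \<in> labellings (2 ^ Suc k) w. unshuffle z = deck}"
  proof (rule bij_betw_same_card[symmetric])
    let ?L = "labellings (2 * 2 ^ k) w"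
    note bij = bij_betw_digits[of "2 ^ k" w]
    have "bij_betw digits {z \<in> ?L. unshuffle z = deck} (digits ` {z \<in> ?L. unshuffle z = deck})"
      by (rule bij_betw_subset[OF bij]) auto
    moreover have "digits ` {z \<in> ?L. unshuffle z = deck} = {t \<in> digits ` ?L. unshuffle (snd t) = deck}"
      by (force simp: unshuffle_snd_digits)
    ultimately have "bij_betw digits {z \<in> ?L. unshuffle z = deck}
       {t \<in> (SIGMA b : labellings 2 w. labellings (2 ^ k) (unshuffle b)). unshuffle (snd t) = deck}"
      using bij_betw_imp_surj_on[OF bij] by simp
    moreover have "{t \<in> (SIGMA b : labellings 2 w. labellings (2 ^ k) (unshuffle b)). unshuffle (snd t) = deck}
        = (SIGMA b : labellings 2 w. ?A (unshuffle b))"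
      by auto
    ultimately show "bij_betw digits {z \<in> labellings (2 ^ Suc k) w. unshuffle z = deck} (SIGMA b : labellings 2 w. ?A (unshuffle b))"
      by simp
  qed
  finally show ?case .
qed

section \<open>The least likely configuration\<close>

text \<open>The number of ways to label blocks of sizes \<open>D\<^sub>1\<close>, \<open>D\<^sub>2\<close>, and so on with labels below \<open>x\<close> such that the labels
  of each block are strictly below those of the next (\<open>card_separated\<close>). The summation index \<open>k\<close> is one more than the
  largest label in the first block, which leaves \<open>x - k\<close> labels for the other blocks. A single remaining block is unrestricted.\<close>

primrec sep_count :: "nat list \<Rightarrow> nat \<Rightarrow> real" where
  "sep_count [] x = 1"
| "sep_count (D # Ds) x = (if Ds = [] then real x ^ D else
     (\<Sum>k=1..x. (real k ^ D - (real k - 1) ^ D) * sep_count Ds (x - k)))"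

lemma sep_count_eq_0:
  assumes "Ds \<noteq> []" "\<forall>D\<in>set Ds. 0 < D" "x < length Ds"
  shows "sep_count Ds x = 0"
  using assms
proof (induction Ds arbitrary: x)
  case (Cons D Ds)
  show ?case
  proof (cases "Ds = []")
    case False
    have "sep_count Ds (x - k) = 0" if "k \<in> {1..x}" for k
      using that Cons.prems False by (intro Cons.IH) auto
    then show ?thesis using False by simp
  qed (use Cons.prems in auto)
qed simp

definition separated :: "(nat \<times> 'a::linorder) list \<Rightarrow> bool" where
  "separated z \<longleftrightarrow> (\<forall>p\<in>set z. \<forall>q\<in>set z. snd p < snd q \<longrightarrow> fst p < fst q)"

text \<open>Whatever the order of the cards, separated labels alone determine the order by type.\<close>

lemma separated_imp_unshuffle:
  assumes "separated z" "mset (map snd z) = mset deck" "sorted deck"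
  shows "unshuffle z = deck"
proof -
  have "sorted_wrt (\<lambda>x y. fst x \<le> fst y) (sort_key fst z)"
    using sorted_sort_key[of fst z] by (simp add: sorted_map)
  then have "sorted_wrt (\<lambda>x y. snd x \<le> snd y) (sort_key fst z)"
  proof (rule sorted_wrt_mono_rel[rotated])
    fix x y assume "x \<in> set (sort_key fst z)" "y \<in> set (sort_key fst z)" "fst x \<le> fst y"
    then have "x \<in> set z" "y \<in> set z" "\<not> fst y < fst x" by simp_all
    then have "\<not> snd y < snd x" using assms(1) unfolding separated_def by blast
    then show "snd x \<le> snd y" by simp
  qed
  then have "sorted (unshuffle z)" by (simp add: unshuffle_def sorted_map)
  moreover have "mset (unshuffle z) = mset deck" using assms(2) by (simp add: unshuffle_def)
  ultimately have "sort deck = unshuffle z" by (intro properties_for_sort) auto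
  then show ?thesis using assms(3) by (simp add: sorted_sort_id)
qed

lemma sorted_wrt_key_less:
  fixes g :: "'b \<Rightarrow> 'c::linorder"
  assumes "sorted_wrt (\<lambda>x y. g x \<le> g y) xs" "p \<in> set xs" "q \<in> set xs" "g p < g q" "sorted_wrt R xs"
  shows "R p q"
proof -
  obtain i j where ij: "i < length xs" "xs ! i = p" "j < length xs" "xs ! j = q"
    using assms(2,3) by (metis in_set_conv_nth)
  have "i < j"
  proof (rule ccontr)
    assume "\<not> i < j"
    then consider "i = j" | "j < i" by linarith
    then show False
    proof cases
      case 1
      then show ?thesis using ij assms(4) by simp
    next
      case 2
      from sorted_wrt_nth_less[OF assms(1) this ij(1)] ij assms(4) show ?thesis by simp
    qed
  qed
  from sorted_wrt_nth_less[OF assms(5) this ij(3)] ij show ?thesis by simp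
qed

text \<open>Cards of equal label keep their relative order, which in the reversed deck is descending by type;
  a sorted result therefore forces different types to carry different labels.\<close>

lemma unshuffle_reverse_imp_separated:
  assumes "map snd z = rev deck" "sorted deck" "unshuffle z = deck"
  shows "separated z"
  unfolding separated_def
proof (intro ballI impI)
  fix p q assume pq: "p \<in> set z" "q \<in> set z" "snd p < snd q"
  let ?ys = "sort_key fst z"
  have asc: "sorted_wrt (\<lambda>x y. snd x \<le> snd y) ?ys"
  proof -
    have "sorted (map snd ?ys)" using assms(2,3) by (simp only: unshuffle_def)
    then show ?thesis by (simp only: sorted_map)
  qed
  have key: "sorted_wrt (\<lambda>x y. fst x \<le> fst y) ?ys"
    using sorted_sort_key[of fst z] by (simp add: sorted_map)
  from sorted_wrt_key_less[of snd ?ys p q "\<lambda>x y. fst x \<le> fst y", OF asc _ _ pq(3) key] pq have le: "fst p \<le> fst q" by simp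
  have "fst p \<noteq> fst q"
  proof
    assume eq: "fst p = fst q"
    let ?u = "filter (\<lambda>x. fst x = fst p) z"
    have "filter (\<lambda>x. fst x = fst p) ?ys = ?u" by (rule sort_key_stable)
    then have up: "sorted_wrt (\<lambda>x y. snd x \<le> snd y) ?u"
      using sorted_wrt_filter[OF asc, of "\<lambda>x. fst x = fst p"] by (simp only:)
    have "sorted_wrt (\<lambda>x y. snd y \<le> snd x) z"
    proof -
      have "sorted_wrt (\<lambda>x y. y \<le> x) (map snd z)"
        unfolding assms(1) sorted_wrt_rev by (rule assms(2))
      then show ?thesis by (simp only: sorted_wrt_map)
    qed
    then have down: "sorted_wrt (\<lambda>x y. snd y \<le> snd x) ?u"
      by (rule sorted_wrt_filter)
    from sorted_wrt_key_less[of snd ?u p q "\<lambda>x y. snd y \<le> snd x", OF up _ _ pq(3) down] pq eq show False by simp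
  qed
  with le show "fst p < fst q" by simp
qed

lemma filter_partition_inject:
  assumes "map g z = map g z'" "filter (\<lambda>p. P (g p)) z = filter (\<lambda>p. P (g p)) z'"
    "filter (\<lambda>p. \<not> P (g p)) z = filter (\<lambda>p. \<not> P (g p)) z'"
  shows "z = z'"
  using assms
proof (induction z arbitrary: z')
  case (Cons x xs)
  from Cons.prems(1) obtain y ys where z': "z' = y # ys" by (cases z') auto
  have gxy: "g x = g y" and gs: "map g xs = map g ys" using Cons.prems(1) by (simp_all add: z')
  show ?case
  proof (cases "P (g x)")
    case True
    then have "x = y" "filter (\<lambda>p. P (g p)) xs = filter (\<lambda>p. P (g p)) ys"
      "filter (\<lambda>p. \<not> P (g p)) xs = filter (\<lambda>p. \<not> P (g p)) ys"
      using Cons.prems(2,3) gxy by (simp_all add: z')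
    with Cons.IH[OF gs] show ?thesis by (simp add: z')
  next
    case False
    then have "x = y" "filter (\<lambda>p. P (g p)) xs = filter (\<lambda>p. P (g p)) ys"
      "filter (\<lambda>p. \<not> P (g p)) xs = filter (\<lambda>p. \<not> P (g p)) ys"
      using Cons.prems(2,3) gxy by (simp_all add: z')
    with Cons.IH[OF gs] show ?thesis by (simp add: z')
  qed
qed simp

lemma bij_betw_labellings_partition:
  "bij_betw (\<lambda>z. (filter (\<lambda>p. P (snd p)) z, filter (\<lambda>p. \<not> P (snd p)) z))
     (labellings a w) (labellings a (filter P w) \<times> labellings a (filter (\<lambda>x. \<not> P x) w))"
  (is "bij_betw ?f ?L ?R")
proof -
  have inj: "inj_on ?f ?L"
  proof (rule inj_onI)
    fix x y assume x: "x \<in> ?L" and y: "y \<in> ?L" and eq: "?f x = ?f y"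
    have "map snd x = w" using x by (simp add: labellings_def)
    moreover have "map snd y = w" using y by (simp add: labellings_def)
    ultimately have "map snd x = map snd y" by (simp only:)
    moreover have "filter (\<lambda>p. P (snd p)) x = filter (\<lambda>p. P (snd p)) y"
      "filter (\<lambda>p. \<not> P (snd p)) x = filter (\<lambda>p. \<not> P (snd p)) y"
      using eq by (simp_all only: prod.inject)
    ultimately show "x = y" by (rule filter_partition_inject[where g = snd and P = P])
  qed
  moreover have "?f ` ?L = ?R"
  proof (rule card_subset_eq)
    have "(filter (\<lambda>p. P (snd p)) z, filter (\<lambda>p. \<not> P (snd p)) z) \<in> ?R" if z: "z \<in> ?L" for z
    proof -
      have w: "w = map snd z" and "\<forall>p\<in>set z. fst p < a" using z by (auto simp: labellings_def)
      then have "\<forall>p\<in>set (filter Q z). fst p < a" for Q by simp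
      then have "fst ` set (filter Q z) \<subseteq> {..<a}" for Q by blast
      then show ?thesis by (simp add: labellings_def w filter_map o_def del: set_filter)
    qed
    then show "?f ` ?L \<subseteq> ?R" by blast
    show "card (?f ` ?L) = card ?R"
      by (simp add: card_image[OF inj] card_labellings card_cartesian_product sum_length_filter_compl flip: power_add)
  qed simp
  ultimately show ?thesis by (simp add: bij_betw_def)
qed

lemma labellings_mono: "a \<le> b \<Longrightarrow> labellings a w \<subseteq> labellings b w"
  by (auto simp: labellings_def)

text \<open>Labels that are all at least \<open>k\<close> can be lowered by \<open>k\<close>.\<close>

lemma labellings_shift:
  fixes w :: "'a::linorder list"
  shows "card {v \<in> labellings a w. separated v \<and> (\<forall>q\<in>set v. k \<le> fst q)} = card {v \<in> labellings (a - k) w. separated v}"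
    (is "card ?A = card ?B")
proof (rule bij_betw_same_card[symmetric])
  let ?up = "map (apfst (\<lambda>i. i + k)) :: (nat \<times> 'a) list \<Rightarrow> (nat \<times> 'a) list"
    and ?down = "map (apfst (\<lambda>i. i - k)) :: (nat \<times> 'a) list \<Rightarrow> (nat \<times> 'a) list"
  show "bij_betw ?up ?B ?A"
  proof (rule bij_betw_byWitness[where f' = ?down])
    have "apfst (\<lambda>i. i - k) (apfst (\<lambda>i. i + k) q) = q" for q :: "nat \<times> 'a"
      by (cases q) simp
    then show "\<forall>v\<in>?B. ?down (?up v) = v"
      by (simp add: o_def)
    show "\<forall>v\<in>?A. ?up (?down v) = v"
    proof
      fix v assume "v \<in> ?A"
      then have "apfst (\<lambda>i. i + k) (apfst (\<lambda>i. i - k) q) = q" if "q \<in> set v" for q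
        using that by (cases q) auto
      then show "?up (?down v) = v" by (simp add: map_idI)
    qed
    show "?up ` ?B \<subseteq> ?A"
    proof
      fix x assume "x \<in> ?up ` ?B"
      then obtain v where v: "v \<in> labellings (a - k) w" "separated v" "x = ?up v" by blast
      have "fst q < a - k" if "q \<in> set v" for q
        using v(1) that by (auto simp: labellings_def)
      then have "fst q + k < a" if "q \<in> set v" for q
        using that less_diff_conv by blast
      then have "x \<in> labellings a w"
        using v(1) by (auto simp: v(3) labellings_def)
      moreover have "separated x"
        using v(2) unfolding v(3) separated_def by simp
      ultimately show "x \<in> ?A" by (simp add: v(3))
    qed
    show "?down ` ?A \<subseteq> ?B"
    proof
      fix x assume "x \<in> ?down ` ?A"
      then obtain v where v: "v \<in> labellings a w" "separated v" "\<forall>q\<in>set v. k \<le> fst q" "x = ?down v" by blast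
      have "fst q < a" if "q \<in> set v" for q
        using v(1) that by (auto simp: labellings_def)
      then have "fst q - k < a - k" if "q \<in> set v" for q
        using v(3) that by (simp add: diff_less_mono)
      then have "x \<in> labellings (a - k) w"
        using v(1) by (auto simp: v(4) labellings_def)
      moreover have "separated x"
        using v(2,3) unfolding v(4) separated_def by (simp add: diff_less_mono)
      ultimately show "x \<in> ?B" by simp
    qed
  qed
qed

text \<open>Splitting off the cards of the smallest type \<open>t\<close> and classifying by the largest label \<open>k - 1\<close> among
  them gives the recursion of \<open>sep_count\<close>: there are \<open>k ^ D - (k - 1) ^ D\<close> labellings of those \<open>D\<close> cards with largest label
  \<open>k - 1\<close>, and the other cards must use labels from \<open>k\<close> on.\<close>

lemma card_separated:
  assumes "sorted_wrt (<) ts" "set w \<subseteq> set ts" "\<forall>t\<in>set ts. 0 < count_list w t" "ts \<noteq> []"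
  shows "real (card {z \<in> labellings a w. separated z}) = sep_count (map (count_list w) ts) a"
  using assms
proof (induction ts arbitrary: w a)
  case (Cons t ts)
  show ?case
  proof (cases "ts = []")
    case True
    then have w: "\<forall>x\<in>set w. x = t" using Cons.prems by auto
    then have "filter ((=) t) w = w" by (auto simp: filter_id_conv)
    then have "count_list w t = length w" by (simp add: count_list_eq_length_filter)
    moreover have "separated z" if "z \<in> labellings a w" for z
    proof -
      have "snd p = t" if "p \<in> set z" for p
        using w \<open>z \<in> labellings a w\<close> that by (auto simp: labellings_def)
      then show ?thesis by (simp add: separated_def)
    qed
    then have "{z \<in> labellings a w. separated z} = labellings a w" by blast
    ultimately show ?thesis using True by (simp add: card_labellings)
  next
    case False
    define u where "u = filter (\<lambda>x. x = t) w"
    define v where "v = filter (\<lambda>x. x \<noteq> t) w"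
    define f where "f = (\<lambda>z :: (nat \<times> 'a) list. (filter (\<lambda>p. snd p = t) z, filter (\<lambda>p. snd p \<noteq> t) z))"
    \<comment> \<open>Labellings of the cards of type \<open>t\<close> with largest label exactly \<open>k - 1\<close>.\<close>
    define U where "U k = labellings k u - labellings (k - 1) u" for k
    define V where "V k = {y \<in> labellings a v. separated y \<and> (\<forall>q\<in>set y. k \<le> fst q)}" for k
    have bij: "bij_betw f (labellings a w) (labellings a u \<times> labellings a v)"
      using bij_betw_labellings_partition[of "\<lambda>x. x = t" a w] by (simp add: f_def u_def v_def)
    have lenu: "length u = count_list w t"
      unfolding u_def count_list_eq_length_filter by (intro arg_cong[of _ _ length] filter_cong) auto
    then have u0: "u \<noteq> []" using Cons.prems(3) by auto
    have t_less: "t < s" if "s \<in> set ts" for s using Cons.prems(1) that by auto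
    have v_greater: "t < s" if "s \<in> set v" for s
      using that Cons.prems(2) t_less by (auto simp: v_def)
    have sep_iff: "separated z \<longleftrightarrow> separated (snd (f z)) \<and> (\<forall>p\<in>set (fst (f z)). \<forall>q\<in>set (snd (f z)). fst p < fst q)"
      if "z \<in> labellings a w" for z
    proof -
      have "snd q \<in> set w" if "q \<in> set z" for q
        using \<open>z \<in> _\<close> that by (auto simp: labellings_def)
      then have "snd q \<in> insert t (set ts)" if "q \<in> set z" for q
        using that Cons.prems(2) by (metis list.set(2) subsetD)
      with t_less have "snd q = t \<or> t < snd q" if "q \<in> set z" for q
        using that by (metis insertE)
      then have t_min: "t \<le> snd q" if "q \<in> set z" for q
        using that by (metis order_refl less_imp_le)
      have fz: "fst (f z) = filter (\<lambda>p. snd p = t) z" "snd (f z) = filter (\<lambda>p. snd p \<noteq> t) z"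
        by (simp_all add: f_def)
      show ?thesis
      proof
        assume sep: "separated z"
        have "fst p < fst q" if "p \<in> set (fst (f z))" "q \<in> set (snd (f z))" for p q
        proof -
          have "p \<in> set z" "q \<in> set z" "snd p = t" "snd q \<noteq> t" using that by (simp_all add: fz)
          moreover from this t_min[of q] have "snd p < snd q" by simp
          ultimately show ?thesis using sep unfolding separated_def by blast
        qed
        moreover have "separated (snd (f z))"
          using sep unfolding separated_def fz by simp
        ultimately show "separated (snd (f z)) \<and> (\<forall>p\<in>set (fst (f z)). \<forall>q\<in>set (snd (f z)). fst p < fst q)"
          by blast
      next
        assume R: "separated (snd (f z)) \<and> (\<forall>p\<in>set (fst (f z)). \<forall>q\<in>set (snd (f z)). fst p < fst q)"
        show "separated z"
          unfolding separated_def
        proof (intro ballI impI)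
          fix p q assume pq: "p \<in> set z" "q \<in> set z" "snd p < snd q"
          then have "snd q \<noteq> t" using t_min[of p] by auto
          then have q: "q \<in> set (snd (f z))" using pq by (simp add: fz)
          show "fst p < fst q"
          proof (cases "snd p = t")
            case True
            then have "p \<in> set (fst (f z))" using pq by (simp add: fz)
            with R q show ?thesis by blast
          next
            case False
            then have "p \<in> set (snd (f z))" using pq by (simp add: fz)
            with R q pq(3) show ?thesis unfolding separated_def by blast
          qed
        qed
      qed
    qed
    have U_sub: "U k \<subseteq> labellings a u" if "k \<le> a" for k
      using labellings_mono[OF that] by (auto simp: U_def)
    have U_iff: "(\<forall>p\<in>set x. \<forall>q\<in>set y. fst p < fst q) \<longleftrightarrow> (\<forall>q\<in>set y. k \<le> fst q)"
      if x: "x \<in> U k" for x k and y :: "(nat \<times> 'a) list"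
    proof -
      have "\<forall>p\<in>set x. fst p < k" using x by (auto simp: U_def labellings_def)
      moreover have "\<exists>p\<in>set x. \<not> fst p < k - 1"
        using x by (auto simp: U_def labellings_def image_subset_iff)
      then obtain p where "p \<in> set x" "k - 1 \<le> fst p"
        by (auto simp: not_less)
      ultimately show ?thesis by fastforce
    qed
    have U_ex: "\<exists>k\<in>{1..a}. x \<in> U k" if "x \<in> labellings a u" for x
    proof -
      define k where "k = (LEAST k. x \<in> labellings k u)"
      have k: "x \<in> labellings k u" unfolding k_def using that by (rule LeastI)
      have "k \<le> a" unfolding k_def using that by (rule Least_le)
      moreover have "k \<noteq> 0" using k u0 by (auto simp: labellings_def)
      moreover have "x \<notin> labellings (k - 1) u"
        using \<open>k \<noteq> 0\<close> not_less_Least[of "k - 1" "\<lambda>k. x \<in> labellings k u"] by (simp add: k_def)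
      ultimately show ?thesis using k by (auto simp: U_def)
    qed
    have U_disj: "U k \<inter> U l = {}" if "k < l" for k l
    proof -
      have "labellings k u \<subseteq> labellings (l - 1) u"
        using that by (intro labellings_mono) simp
      then show ?thesis by (auto simp: U_def)
    qed
    have img: "f ` {z \<in> labellings a w. separated z} = (\<Union>k\<in>{1..a}. U k \<times> V k)"
    proof (intro equalityI subsetI)
      fix xy assume "xy \<in> f ` {z \<in> labellings a w. separated z}"
      then obtain z where z: "z \<in> labellings a w" "separated z" "xy = f z" by blast
      have xy: "fst xy \<in> labellings a u" "snd xy \<in> labellings a v"
        using bij_betwE[OF bij] z(1,3) by (auto simp: mem_Times_iff)
      obtain k where k: "k \<in> {1..a}" "fst xy \<in> U k" using U_ex[OF xy(1)] by blast
      have "snd xy \<in> V k"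
        using xy(2) z sep_iff[OF z(1)] U_iff[OF k(2), of "snd xy"] by (simp add: V_def)
      with k show "xy \<in> (\<Union>k\<in>{1..a}. U k \<times> V k)" by (auto simp: mem_Times_iff)
    next
      fix xy assume "xy \<in> (\<Union>k\<in>{1..a}. U k \<times> V k)"
      then obtain k where k: "k \<in> {1..a}" "fst xy \<in> U k" "snd xy \<in> V k" by (auto simp: mem_Times_iff)
      then have "xy \<in> labellings a u \<times> labellings a v"
        using U_sub[of k] by (auto simp: V_def mem_Times_iff)
      then obtain z where z: "z \<in> labellings a w" "xy = f z"
        using bij_betw_imp_surj_on[OF bij] by (metis imageE)
      have "separated z"
        using k z sep_iff[OF z(1)] U_iff[OF k(2), of "snd xy"] by (simp add: V_def)
      with z show "xy \<in> f ` {z \<in> labellings a w. separated z}" by blast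
    qed
    have "card {z \<in> labellings a w. separated z} = card (f ` {z \<in> labellings a w. separated z})"
      by (rule card_image[symmetric], rule inj_on_subset[OF bij_betw_imp_inj_on[OF bij]]) auto
    also have "\<dots> = (\<Sum>k=1..a. card (U k \<times> V k))"
      unfolding img
    proof (rule card_UN_disjoint)
      show "\<forall>i\<in>{1..a}. \<forall>j\<in>{1..a}. i \<noteq> j \<longrightarrow> U i \<times> V i \<inter> U j \<times> V j = {}"
        using U_disj by (metis Sigma_empty1 Times_Int_Times inf_commute linorder_neqE_nat)
    qed (auto simp: U_def V_def)
    also have "\<dots> = (\<Sum>k=1..a. card (U k) * card (V k))"
      by (simp add: card_cartesian_product)
    finally have "real (card {z \<in> labellings a w. separated z}) = (\<Sum>k=1..a. real (card (U k)) * real (card (V k)))"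
      by simp
    also have "\<dots> = (\<Sum>k=1..a. (real k ^ count_list w t - (real k - 1) ^ count_list w t) * sep_count (map (count_list w) ts) (a - k))"
    proof (rule sum.cong)
      fix k assume k: "k \<in> {1..a}"
      have "card (U k) = k ^ length u - (k - 1) ^ length u"
        unfolding U_def by (subst card_Diff_subset) (auto simp: card_labellings intro: subsetD[OF labellings_mono, rotated])
      moreover have "(k - 1) ^ length u \<le> k ^ length u" by (rule power_mono) auto
      ultimately have "real (card (U k)) = real k ^ count_list w t - (real k - 1) ^ count_list w t"
        using k by (simp add: lenu of_nat_diff)
      moreover have "count_list v s = count_list w s" if "s \<in> set ts" for s
        using t_less[OF that] by (simp add: v_def count_list_eq_length_filter) (metis (mono_tags, lifting) less_irrefl)
      then have "map (count_list v) ts = map (count_list w) ts" "\<forall>s\<in>set ts. 0 < count_list v s"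
        using Cons.prems(3) by auto
      then have "real (card (V k)) = sep_count (map (count_list w) ts) (a - k)"
      proof -
        assume cl: "map (count_list v) ts = map (count_list w) ts" "\<forall>s\<in>set ts. 0 < count_list v s"
        have "set v \<subseteq> set ts" using Cons.prems(2) by (auto simp: v_def)
        from Cons.IH[OF _ this cl(2) False, of "a - k"] Cons.prems(1) show ?thesis
          unfolding V_def labellings_shift cl(1) by simp
      qed
      ultimately show "real (card (U k)) * real (card (V k))
         = (real k ^ count_list w t - (real k - 1) ^ count_list w t) * sep_count (map (count_list w) ts) (a - k)"
        by simp
    qed simp
    finally show ?thesis using False by simp
  qed
qed simp

lemma sorted_sorted_deck: "sorted (sorted_deck m D)"
  unfolding sorted_deck_def by (induction m) (auto simp: sorted_append sorted_replicate)

lemma mset_configuration: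
  assumes "w \<in> configurations m D" "w' \<in> configurations m D"
  shows "mset w = mset w'"
proof (rule multiset_eqI)
  have "count_list w x = (if x \<in> {1..m} then D x else 0)" if "w \<in> configurations m D" for w x
    using that by (auto simp: configurations_def count_list_0_iff)
  then show "count (mset w) x = count (mset w') x" for x
    using assms by (simp add: count_mset)
qed

text \<open>Separated labellings are counted for every configuration, and they are the only ones counted for
  the reversed deck, which therefore attains the maximum.\<close>

lemma separation_distance_eq:
  assumes "1 \<le> m" "\<forall>i\<in>{1..m}. 0 < D i" "n = (\<Sum>i=1..m. D i)"
  shows "separation_distance m D k
    = 1 - sep_count (map D [1..<m+1]) (2 ^ k) / (2 ^ k) ^ n / uniform_prob m D"
proof -
  let ?deck = "sorted_deck m D"
  let ?S = "sep_count (map D [1..<m+1]) (2 ^ k)"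
  have len: "length ?deck = n"
    using length_configuration[OF sorted_deck_in_configurations] assms(3) by simp
  have cnt: "real (card {z \<in> labellings (2 ^ k) w. separated z}) = ?S" if w: "w \<in> configurations m D" for w
  proof -
    have "map (count_list w) [1..<m+1] = map D [1..<m+1]"
      using w by (auto simp: configurations_def)
    moreover have "real (card {z \<in> labellings (2 ^ k) w. separated z}) = sep_count (map (count_list w) [1..<m+1]) (2 ^ k)"
      using w assms by (intro card_separated) (auto simp: configurations_def simp del: upt_Suc)
    ultimately show ?thesis by (simp only:)
  qed
  have rev: "rev ?deck \<in> configurations m D"
    using sorted_deck_in_configurations[of m D] by (simp add: configurations_def)
  have U: "0 < uniform_prob m D"
    by (simp add: uniform_prob_def prod_pos)
  have sep_sorts: "unshuffle z = ?deck"
    if w: "w \<in> configurations m D" and z: "z \<in> labellings (2 ^ k) w" "separated z" for w z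
  proof (rule separated_imp_unshuffle[OF z(2) _ sorted_sorted_deck])
    have "map snd z = w" using z(1) by (simp add: labellings_def)
    then show "mset (map snd z) = mset ?deck"
      using mset_configuration[OF w sorted_deck_in_configurations] by (simp only:)
  qed
  have ge: "?S / (2 ^ k) ^ n \<le> pmf (riffle_shuffles k ?deck) w" if w: "w \<in> configurations m D" for w
  proof -
    have "{z \<in> labellings (2 ^ k) w. separated z} \<subseteq> {z \<in> labellings (2 ^ k) w. unshuffle z = ?deck}"
      using sep_sorts[OF w] by blast
    then have "card {z \<in> labellings (2 ^ k) w. separated z} \<le> card {z \<in> labellings (2 ^ k) w. unshuffle z = ?deck}"
      by (intro card_mono) auto
    then show ?thesis
      unfolding pmf_riffle_shuffles len cnt[OF w, symmetric] by (intro divide_right_mono) auto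
  qed
  have "{z \<in> labellings (2 ^ k) (rev ?deck). unshuffle z = ?deck} = {z \<in> labellings (2 ^ k) (rev ?deck). separated z}"
  proof -
    have "separated z" if "z \<in> labellings (2 ^ k) (rev ?deck)" "unshuffle z = ?deck" for z
      using that unshuffle_reverse_imp_separated[OF _ sorted_sorted_deck] by (simp add: labellings_def)
    then show ?thesis using sep_sorts[OF rev] by blast
  qed
  then have eq: "pmf (riffle_shuffles k ?deck) (rev ?deck) = ?S / (2 ^ k) ^ n"
    unfolding pmf_riffle_shuffles len cnt[OF rev, symmetric] by simp
  show ?thesis
    unfolding separation_distance_def
  proof (rule Max_eqI)
    show "finite ((\<lambda>w. 1 - pmf (riffle_shuffles k ?deck) w / uniform_prob m D) ` configurations m D)"
      by (simp add: finite_configurations)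
    show "1 - ?S / (2 ^ k) ^ n / uniform_prob m D \<in> (\<lambda>w. 1 - pmf (riffle_shuffles k ?deck) w / uniform_prob m D) ` configurations m D"
      using rev eq by (intro image_eqI[of _ _ "rev ?deck"]) auto
    fix y assume "y \<in> (\<lambda>w. 1 - pmf (riffle_shuffles k ?deck) w / uniform_prob m D) ` configurations m D"
    then obtain w where w: "w \<in> configurations m D" "y = 1 - pmf (riffle_shuffles k ?deck) w / uniform_prob m D"
      by blast
    have "?S / (2 ^ k) ^ n / uniform_prob m D \<le> pmf (riffle_shuffles k ?deck) w / uniform_prob m D"
      using ge[OF w(1)] U by (intro divide_right_mono) auto
    then show "y \<le> 1 - ?S / (2 ^ k) ^ n / uniform_prob m D"
      unfolding w(2) by linarith
  qed
qed

section \<open>The trapezoid rule for Beta integrands\<close>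

lemma DERIV_power_Suc_diff:
  "((\<lambda>x::real. (T - x) ^ Suc b) has_real_derivative - (real (Suc b) * (T - x) ^ b)) (at x within A)"
  by (rule DERIV_cong[OF DERIV_power_Suc[where D = "-1"]]) (auto intro!: derivative_eq_intros)

lemma DERIV_power_Suc_mult:
  "((\<lambda>x::real. x ^ Suc a * (T - x) ^ Suc b) has_real_derivative
     real (Suc a) * (x ^ a * (T - x) ^ Suc b) - real (Suc b) * (x ^ Suc a * (T - x) ^ b)) (at x within A)"
proof -
  have "((\<lambda>x. x ^ Suc a) has_real_derivative real (Suc a) * x ^ a) (at x within A)"
    by (rule DERIV_cong[OF DERIV_power_Suc[where D = 1]]) auto
  from DERIV_mult[OF this DERIV_power_Suc_diff] show ?thesis
    by (rule DERIV_cong) (simp only: algebra_simps mult_minus_left mult_minus_right)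
qed

lemma has_integral_beta_nat:
  fixes T :: real
  assumes "0 \<le> T"
  shows "((\<lambda>x. x ^ a * (T - x) ^ b) has_integral
           (fact a * fact b / fact (a + b + 1) * T ^ (a + b + 1))) {0..T}"
proof (induction a arbitrary: b)
  case 0
  have "((\<lambda>x. (T - x) ^ b) has_integral (- ((T - T) ^ (b+1) / real (b+1)) - (- ((T - 0) ^ (b+1) / real (b+1))))) {0..T}"
    by (rule fundamental_theorem_of_calculus[OF assms])
       (auto intro!: DERIV_cong[OF DERIV_minus[OF DERIV_cdivide[OF DERIV_power_Suc_diff[of T b]]]]
         simp flip: has_real_derivative_iff_has_vector_derivative simp del: power_Suc)
  moreover have "fact 0 * fact b / fact (0 + b + 1) = 1 / real (b + 1)"
    by (simp add: divide_simps del: of_nat_Suc)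
  ultimately show ?case by (simp del: of_nat_Suc fact_Suc)
next
  case (Suc a)
  have "((\<lambda>x. real (a+1) * (x ^ a * (T - x) ^ (b+1)) - real (b+1) * (x ^ Suc a * (T - x) ^ b)) has_integral
      (T ^ Suc a * (T - T) ^ Suc b - 0 ^ Suc a * (T - 0) ^ Suc b)) {0..T}"
    using fundamental_theorem_of_calculus[OF assms, of "\<lambda>x. x ^ Suc a * (T - x) ^ Suc b",
        OF DERIV_power_Suc_mult[THEN has_real_derivative_iff_has_vector_derivative[THEN iffD1]]]
    unfolding Suc_eq_plus1 .
  then have 1: "((\<lambda>x. real (a+1) * (x ^ a * (T - x) ^ (b+1)) - real (b+1) * (x ^ Suc a * (T - x) ^ b)) has_integral 0) {0..T}"
    by simp
  have "((\<lambda>x. (real (a+1) * (x ^ a * (T - x) ^ (b+1)) - (real (a+1) * (x ^ a * (T - x) ^ (b+1)) - real (b+1) * (x ^ Suc a * (T - x) ^ b))) / real (b+1))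
     has_integral (real (a+1) * (fact a * fact (b+1) / fact (a + (b+1) + 1) * T ^ (a + (b+1) + 1)) - 0) / real (b+1)) {0..T}"
    by (intro has_integral_divide has_integral_diff has_integral_mult_right Suc.IH 1)
  moreover have "(A - (A - real (b+1) * z)) / real (b+1) = z" for A z :: real
    by (simp del: of_nat_Suc of_nat_add)
  moreover have "(real (a+1) * (fact a * fact (b+1) / fact (a + (b+1) + 1) * T ^ (a + (b+1) + 1)) - 0) / real (b+1)
     = fact (Suc a) * fact b / fact (Suc a + b + 1) * T ^ (Suc a + b + 1)"
  proof -
    have "A * (B * (C * fact b) / E * S) / C = A * B * fact b / E * S"
      if "C \<noteq> 0" for A B C E S :: real
      using that by simp
    from this[of "real (b+1)" "real (a+1)" "fact a" "fact (Suc a + b + 1)" "T ^ (Suc a + b + 1)"]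
    show ?thesis by (simp add: mult_ac)
  qed
  ultimately show ?case by (simp only:)
qed

text \<open>The cut-off at \<open>0\<close> and \<open>T\<close> allows sums over grids that are not aligned with the interval
  and integrals over any larger interval.\<close>

definition bump :: "real \<Rightarrow> nat \<Rightarrow> nat \<Rightarrow> real \<Rightarrow> real" where
  "bump T a b x = (if 0 < x \<and> x < T then x ^ a * (T - x) ^ b else 0)"

lemma bump_nonneg: "0 \<le> bump T a b x"
  by (simp add: bump_def)

lemma has_integral_bump:
  assumes "0 \<le> T" "{0..T} \<subseteq> A"
  shows "(bump T a b has_integral (fact a * fact b / fact (a + b + 1) * T ^ (a + b + 1))) A"
proof -
  have "(bump T a b has_integral (fact a * fact b / fact (a + b + 1) * T ^ (a + b + 1))) {0..T}"
    by (rule has_integral_spike_finite[OF _ _ has_integral_beta_nat[OF assms(1)], of "{0,T}"])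
       (auto simp: bump_def)
  then show ?thesis
    by (rule has_integral_on_superset) (use assms in \<open>auto simp: bump_def\<close>)
qed

lemma bump_max: "bump T (Suc a) (Suc b) x = max 0 x ^ Suc a * max 0 (T - x) ^ Suc b"
  by (auto simp: bump_def max_def)

lemma continuous_on_bump: "continuous_on A (bump T (Suc a) (Suc b))"
  unfolding bump_max by (intro continuous_intros)

lemma bump_deriv:
  assumes "x \<noteq> 0" "x \<noteq> T"
  shows "(bump T (Suc a) (Suc b) has_real_derivative
           (real (Suc a) * bump T a (Suc b) x - real (Suc b) * bump T (Suc a) b x)) (at x)"
proof (cases "0 < x \<and> x < T")
  case True
  have "((\<lambda>x. x ^ Suc a * (T - x) ^ Suc b) has_real_derivative
           (real (Suc a) * bump T a (Suc b) x - real (Suc b) * bump T (Suc a) b x)) (at x)"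
    using True DERIV_power_Suc_mult[of a T b x UNIV] by (simp add: bump_def del: power_Suc of_nat_Suc)
  then show ?thesis
    by (rule has_field_derivative_transform_within_open[of _ _ _ "{0<..<T}"])
       (use True in \<open>auto simp: bump_def\<close>)
next
  case False
  have "((\<lambda>x. 0) has_real_derivative
           (real (Suc a) * bump T a (Suc b) x - real (Suc b) * bump T (Suc a) b x)) (at x)"
    using False by (auto simp: bump_def)
  moreover have "open (if x < 0 then {..<0} else {T<..})" "x \<in> (if x < 0 then {..<0} else {T<..})"
    using False assms by auto
  ultimately show ?thesis
    by (rule has_field_derivative_transform_within_open) (auto simp: bump_def split: if_splits)
qed

text \<open>Integrating by parts twice shows that the trapezoid rule on a unit interval exceeds the integral
  by the integral of \<open>F''\<close> against the kernel \<open>u * (1 - u) / 2\<close> with \<open>u = x - c\<close>, which lies between \<open>0\<close>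
  and \<open>1/8\<close>. Finitely many exceptional points are allowed since the second derivative of a
  quadratic bump jumps at the ends.\<close>

lemma trapezoid_bounds:
  fixes F F1 P N :: "real \<Rightarrow> real"
  assumes cont: "continuous_on {c..c+1} F" "continuous_on {c..c+1} F1" and S: "finite S"
    and F: "\<And>x. x \<notin> S \<Longrightarrow> (F has_real_derivative F1 x) (at x)"
    and F1: "\<And>x. x \<notin> S \<Longrightarrow> (F1 has_real_derivative P x - N x) (at x)"
    and nonneg: "\<And>x. 0 \<le> P x" "\<And>x. 0 \<le> N x"
    and int: "P integrable_on {c..c+1}" "N integrable_on {c..c+1}"
  shows "(F c + F (c + 1)) / 2 - integral {c..c+1} F \<le> integral {c..c+1} P / 8"
    and "- (integral {c..c+1} N / 8) \<le> (F c + F (c + 1)) / 2 - integral {c..c+1} F"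
proof -
  \<comment> \<open>The Peano kernel of the trapezoid rule.\<close>
  define \<kappa> where "\<kappa> x = (x - c) * (1 - (x - c)) / 2" for x
  have \<kappa>: "0 \<le> \<kappa> x" "\<kappa> x \<le> 1 / 8" if "x \<in> {c..c+1}" for x
  proof -
    show "0 \<le> \<kappa> x" using that by (auto simp: \<kappa>_def)
    have "0 \<le> (x - c - 1/2)\<^sup>2" by simp
    then show "\<kappa> x \<le> 1 / 8" by (simp add: \<kappa>_def power2_eq_square algebra_simps)
  qed
  \<comment> \<open>An antiderivative of \<open>F + \<kappa> * F''\<close>, found by the two integrations by parts.\<close>
  define H where "H x = (x - c - 1/2) * F x + \<kappa> x * F1 x" for x
  have "((\<lambda>x. F x + \<kappa> x * (P x - N x)) has_integral (H (c+1) - H c)) {c..c+1}"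
  proof (rule fundamental_theorem_of_calculus_strong[OF S])
    show "continuous_on {c..c+1} H"
      unfolding H_def \<kappa>_def by (intro continuous_intros cont) auto
    fix x assume "x \<in> {c..c+1} - S"
    then have x: "x \<notin> S" by auto
    have "(H has_real_derivative F x + \<kappa> x * (P x - N x)) (at x)"
    proof -
      have "((\<lambda>x. x - c - 1/2) has_real_derivative 1) (at x)"
        "(\<kappa> has_real_derivative 1/2 - (x - c)) (at x)"
        unfolding \<kappa>_def by (auto intro!: derivative_eq_intros simp: field_simps)
      from DERIV_add[OF DERIV_mult[OF this(1) F[OF x]] DERIV_mult[OF this(2) F1[OF x]]]
      show ?thesis unfolding H_def by (rule DERIV_cong) (simp add: algebra_simps)
    qed
    then show "(H has_vector_derivative F x + \<kappa> x * (P x - N x)) (at x)"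
      by (simp add: has_real_derivative_iff_has_vector_derivative)
  qed auto
  moreover have "H (c+1) - H c = (F c + F (c + 1)) / 2"
    by (simp add: H_def \<kappa>_def field_simps)
  ultimately have G: "((\<lambda>x. F x + \<kappa> x * (P x - N x)) has_integral (F c + F (c + 1)) / 2) {c..c+1}"
    by simp
  have Fi: "F integrable_on {c..c+1}"
    by (rule integrable_continuous_real[OF cont(1)])
  have UB: "((\<lambda>x. F x + P x / 8) has_integral (integral {c..c+1} F + integral {c..c+1} P / 8)) {c..c+1}"
    by (intro has_integral_add has_integral_divide integrable_integral Fi int)
  have "F x + \<kappa> x * (P x - N x) \<le> F x + P x / 8" if "x \<in> {c..c+1}" for x
  proof -
    have "\<kappa> x * P x \<le> 1/8 * P x" "0 \<le> \<kappa> x * N x"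
      using \<kappa>[OF that] nonneg[of x] mult_right_mono[of "\<kappa> x" "1/8" "P x"] by auto
    then show ?thesis by (simp add: algebra_simps)
  qed
  from has_integral_le[OF G UB this]
  show "(F c + F (c + 1)) / 2 - integral {c..c+1} F \<le> integral {c..c+1} P / 8"
    by linarith
  have LB: "((\<lambda>x. F x - N x / 8) has_integral (integral {c..c+1} F - integral {c..c+1} N / 8)) {c..c+1}"
    by (intro has_integral_diff has_integral_divide integrable_integral Fi int)
  have "F x - N x / 8 \<le> F x + \<kappa> x * (P x - N x)" if "x \<in> {c..c+1}" for x
  proof -
    have "\<kappa> x * N x \<le> 1/8 * N x" "0 \<le> \<kappa> x * P x"
      using \<kappa>[OF that] nonneg[of x] mult_right_mono[of "\<kappa> x" "1/8" "N x"] by auto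
    then show ?thesis by (simp add: algebra_simps)
  qed
  from has_integral_le[OF LB G this]
  show "- (integral {c..c+1} N / 8) \<le> (F c + F (c + 1)) / 2 - integral {c..c+1} F"
    by linarith
qed

lemma composite_trapezoid_bounds:
  fixes F F1 P N :: "real \<Rightarrow> real"
  assumes cont: "continuous_on UNIV F" "continuous_on UNIV F1" and S: "finite S"
    and F: "\<And>x. x \<notin> S \<Longrightarrow> (F has_real_derivative F1 x) (at x)"
    and F1: "\<And>x. x \<notin> S \<Longrightarrow> (F1 has_real_derivative P x - N x) (at x)"
    and nonneg: "\<And>x. 0 \<le> P x" "\<And>x. 0 \<le> N x"
    and int: "P integrable_on UNIV" "N integrable_on UNIV"
  shows "(\<Sum>k<K. (F (c + real k) + F (c + real k + 1)) / 2) - integral {c..c+real K} F \<le> integral {c..c+real K} P / 8"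
    and "- (integral {c..c+real K} N / 8) \<le> (\<Sum>k<K. (F (c + real k) + F (c + real k + 1)) / 2) - integral {c..c+real K} F"
proof (induction K)
  have cont': "continuous_on A F" "continuous_on A F1" for A
    using cont continuous_on_subset by blast+
  have int': "P integrable_on {u..v}" "N integrable_on {u..v}" "F integrable_on {u..v}" for u v
    using int integrable_on_subinterval[of _ UNIV u v] by (auto intro: integrable_continuous_real cont')
  note tr = trapezoid_bounds[OF cont' S F F1 nonneg int'(1,2)]
  have split: "integral {c..c+real (Suc K)} G = integral {c..c+real K} G + integral {c+real K..c+real K+1} G"
    if "\<And>u v. G integrable_on {u..v}" for G :: "real \<Rightarrow> real" and K
    using Henstock_Kurzweil_Integration.integral_combine[of c "c + real K" "c+real (Suc K)" G] that by (simp add: algebra_simps)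
  case (Suc K)
  {
    case 1
    show ?case using Suc.IH(1) tr(1)[of "c + real K"]
      by (simp add: split int' del: of_nat_Suc)
  next
    case 2
    show ?case using Suc.IH(2) tr(2)[of "c + real K"]
      by (simp add: split int' add_divide_distrib algebra_simps del: of_nat_Suc)
  }
qed auto


lemma trapezoid_sum_eq:
  fixes F :: "real \<Rightarrow> real"
  shows "(\<Sum>k<K. (F (c + real k) + F (c + real k + 1)) / 2)
    = (\<Sum>k=1..K. F (c + real k)) + (F c - F (c + real K)) / 2"
  by (induction K) (simp_all add: field_simps)

text \<open>Writing \<open>p = a + 2\<close>, \<open>q = b + 2\<close> and \<open>F = x ^ p * (T - x) ^ q\<close>, the second derivative of \<open>F\<close> is
  \<open>F * ((p / x - q / (T - x))\<^sup>2 - (p / x\<^sup>2 + q / (T - x)\<^sup>2))\<close>. The two parts \<open>P\<close> and \<open>N\<close> have the same integral \<open>E\<close>,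
  so both one-sided trapezoid bounds are \<open>E / 8\<close>. Bounding the three terms of \<open>F''\<close>
  separately would lose the small factor \<open>1 / (p - 1) + 1 / (q - 1)\<close>.\<close>

lemma bump_sum_error:
  fixes s T :: real
  assumes s: "0 \<le> s" and T: "0 \<le> T" "T \<le> real K - s"
  shows "\<bar>(\<Sum>k=1..K. bump T (a+2) (b+2) (real k - s))
            - fact (a+2) * fact (b+2) / fact (a+b+5) * T ^ (a+b+5)\<bar>
         \<le> (1 / real (a+1) + 1 / real (b+1)) / 8 * (fact (a+2) * fact (b+2) / fact (a+b+3) * T ^ (a+b+3))"
proof -
  define F where "F = bump T (a+2) (b+2)"
  define F1 where "F1 x = real (a+2) * bump T (a+1) (b+2) x - real (b+2) * bump T (a+2) (b+1) x" for x
  define P where "P x = (real (a+2))\<^sup>2 * bump T a (b+2) x - 2 * real (a+2) * real (b+2) * bump T (a+1) (b+1) x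
       + (real (b+2))\<^sup>2 * bump T (a+2) b x" for x
  define N where "N x = real (a+2) * bump T a (b+2) x + real (b+2) * bump T (a+2) b x" for x
  define E where "E = (1 / real (a+1) + 1 / real (b+1)) * (fact (a+2) * fact (b+2) / fact (a+b+3) * T ^ (a+b+3))"
  have Suc2: "x + 2 = Suc (Suc x)" "x + 1 = Suc x" for x :: nat by auto
  have P_nonneg: "0 \<le> P x" for x
  proof (cases "0 < x \<and> x < T")
    case True
    then have "P x = x ^ a * (T - x) ^ b * (real (a+2) * (T - x) - real (b+2) * x)\<^sup>2"
      by (simp add: P_def bump_def power2_eq_square algebra_simps)
    then show ?thesis using True by simp
  qed (auto simp: P_def bump_def)
  have N_nonneg: "0 \<le> N x" for x
    by (simp add: N_def bump_nonneg)
  have cont: "continuous_on UNIV F" "continuous_on UNIV F1"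
    unfolding F_def F1_def Suc2 by (intro continuous_intros continuous_on_bump)+
  have dF: "(F has_real_derivative F1 x) (at x)" if "x \<notin> {0,T}" for x
    unfolding F_def F1_def Suc2 using that by (intro bump_deriv) auto
  have dF1: "(F1 has_real_derivative P x - N x) (at x)" if "x \<notin> {0,T}" for x
  proof -
    have "(F1 has_real_derivative real (a+2) * (real (a+1) * bump T a (b+2) x - real (b+2) * bump T (a+1) (b+1) x)
         - real (b+2) * (real (a+2) * bump T (a+1) (b+1) x - real (b+1) * bump T (a+2) b x)) (at x)"
      unfolding F1_def Suc2 using that by (intro DERIV_diff DERIV_cmult bump_deriv) auto
    then show ?thesis
      by (rule DERIV_cong) (simp add: P_def N_def power2_eq_square algebra_simps)
  qed
  have hP: "(P has_integral E) A" and hN: "(N has_integral E) A" and hF: "(F has_integral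
      fact (a+2) * fact (b+2) / fact (a+b+5) * T ^ (a+b+5)) A"
    if A: "{0..T} \<subseteq> A" for A
  proof -
    note h = has_integral_bump[OF T(1) A]
    have fa: "fact (a+2) = real (a+2) * (real (a+1) * fact a)" "fact (a+1) = real (a+1) * fact a"
      "fact (b+2) = real (b+2) * (real (b+1) * fact b)" "fact (b+1) = real (b+1) * fact b"
      by (simp_all add: algebra_simps)
    have ex: "a + (b+2) + 1 = a+b+3" "(a+1) + (b+1) + 1 = a+b+3" "a + 2 + b + 1 = a+b+3" "(a+2)+(b+2)+1 = a+b+5"
      by simp_all
    have "real (a+1) \<noteq> 0" "real (b+1) \<noteq> 0" by simp_all
    note nz = this
    have eN: "real (a+2) * (fact a * fact (b+2) / fact (a+b+3) * T ^ (a+b+3))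
       + real (b+2) * (fact (a+2) * fact b / fact (a+b+3) * T ^ (a+b+3)) = E"
      unfolding E_def fa using nz by (simp add: divide_simps del: of_nat_add fact_Suc) (simp add: algebra_simps)
    show "(N has_integral E) A"
      using has_integral_add[OF has_integral_mult_right[OF h, of "real (a+2)" a "b+2"] has_integral_mult_right[OF h, of "real (b+2)" "a+2" b]]
      unfolding ex eN N_def[symmetric] .
    have eP: "(real (a+2))\<^sup>2 * (fact a * fact (b+2) / fact (a+b+3) * T ^ (a+b+3))
       - 2 * real (a+2) * real (b+2) * (fact (a+1) * fact (b+1) / fact (a+b+3) * T ^ (a+b+3))
       + (real (b+2))\<^sup>2 * (fact (a+2) * fact b / fact (a+b+3) * T ^ (a+b+3)) = E"
      unfolding E_def fa using nz by (simp add: divide_simps power2_eq_square del: of_nat_add fact_Suc) (simp add: algebra_simps)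
    show "(P has_integral E) A"
      using has_integral_add[OF has_integral_diff[OF has_integral_mult_right[OF h, of "(real (a+2))\<^sup>2" a "b+2"]
           has_integral_mult_right[OF h, of "2 * real (a+2) * real (b+2)" "a+1" "b+1"]]
           has_integral_mult_right[OF h, of "(real (b+2))\<^sup>2" "a+2" b]]
      unfolding ex eP P_def[symmetric] .
    show "(F has_integral fact (a+2) * fact (b+2) / fact (a+b+5) * T ^ (a+b+5)) A"
      using h[of "a+2" "b+2"] unfolding ex F_def .
  qed
  have sub: "{0..T} \<subseteq> {-s .. -s + real K}" using s T by auto
  have "F (-s) = 0" "F (-s + real K) = 0" using s T by (simp_all add: F_def bump_def)
  then have tr: "(\<Sum>k<K. (F (-s + real k) + F (-s + real k + 1)) / 2) = (\<Sum>k=1..K. F (real k - s))"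
    unfolding trapezoid_sum_eq by simp
  have int: "P integrable_on UNIV" "N integrable_on UNIV"
    using hP[of UNIV] hN[of UNIV] by auto
  note bounds = composite_trapezoid_bounds[where S = "{0,T}", OF cont finite.insertI[OF finite.insertI[OF finite.emptyI]] dF dF1 P_nonneg N_nonneg int, where c = "-s" and K = K]
  have "\<bar>(\<Sum>k=1..K. F (real k - s)) - fact (a+2) * fact (b+2) / fact (a+b+5) * T ^ (a+b+5)\<bar> \<le> E / 8"
    using bounds unfolding tr integral_unique[OF hP[OF sub]] integral_unique[OF hN[OF sub]] integral_unique[OF hF[OF sub]]
    by linarith
  then show ?thesis
    unfolding F_def E_def by (simp only: times_divide_eq_left)
qed

section \<open>Truncated powers and means over unit intervals\<close>

text \<open>Truncated powers divided by factorials: \<open>avg\<close> and the Beta integral act on them by shifting the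
  index.\<close>

definition tpow :: "nat \<Rightarrow> real \<Rightarrow> real" where
  "tpow q y = max 0 y ^ q / fact q"

lemma tpow_nonneg: "0 \<le> tpow q y"
  by (simp add: tpow_def)

lemma tpow_eq_0: "y \<le> 0 \<Longrightarrow> 0 < q \<Longrightarrow> tpow q y = 0"
  by (simp add: tpow_def max_def power_0_left)

lemma continuous_on_tpow: "continuous_on A (tpow q)"
  unfolding tpow_def by (intro continuous_intros) auto

text \<open>The mean of \<open>f\<close> over the unit interval that ends at \<open>y\<close>. Written with a fixed domain of integration, it
  visibly preserves inequalities and commutes with translations.\<close>

definition avg :: "(real \<Rightarrow> real) \<Rightarrow> real \<Rightarrow> real" where
  "avg f y = integral {0..1} (\<lambda>s. f (y - s))"

lemma has_integral_avg:
  assumes "continuous_on UNIV f"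
  shows "((\<lambda>s. f (y - s)) has_integral avg f y) {0..1}"
  unfolding avg_def
  by (intro integrable_integral integrable_continuous_real continuous_intros
      continuous_on_compose2[OF assms]) auto

lemma continuous_on_avg:
  assumes "continuous_on UNIV f"
  shows "continuous_on UNIV (avg f)"
proof -
  have "continuous_on (UNIV \<times> cbox 0 1) (\<lambda>(y, s). f (y - s))"
    unfolding split_def by (intro continuous_on_compose2[OF assms] continuous_intros) auto
  from integral_continuous_on_param[OF this] show ?thesis
    by (simp add: avg_def[abs_def])
qed

lemma continuous_on_avg_pow:
  "continuous_on UNIV f \<Longrightarrow> continuous_on UNIV ((avg ^^ r) f)"
  by (induction r) (auto intro: continuous_on_avg)

lemma avg_mono:
  assumes "continuous_on UNIV f" "continuous_on UNIV g" "\<And>s. s \<in> {0..1} \<Longrightarrow> f (y - s) \<le> g (y - s)"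
  shows "avg f y \<le> avg g y"
  using has_integral_le[OF has_integral_avg[OF assms(1)] has_integral_avg[OF assms(2)]] assms(3) by blast

text \<open>The \<open>r\<close>-fold mean at \<open>x\<close> depends only on values in \<open>[x - r, x]\<close>. This locality is what turns the
  bound for \<open>T\<close> into \<open>a - m + 1\<close>.\<close>

lemma avg_pow_mono:
  assumes "continuous_on UNIV f" "continuous_on UNIV g" "\<And>y. x - real r \<le> y \<Longrightarrow> y \<le> x \<Longrightarrow> f y \<le> g y"
  shows "(avg ^^ r) f x \<le> (avg ^^ r) g x"
  using assms(3)
proof (induction r arbitrary: x)
  case (Suc r)
  show ?case
    unfolding funpow.simps o_def
    by (rule avg_mono) (auto intro!: continuous_on_avg_pow assms Suc)
qed auto

lemma avg_sum:
  assumes "\<And>i. i \<in> A \<Longrightarrow> continuous_on UNIV (f i)"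
  shows "avg (\<lambda>y. \<Sum>i\<in>A. c i * f i y) x = (\<Sum>i\<in>A. c i * avg (f i) x)"
proof (cases "finite A")
  case True
  have "((\<lambda>s. \<Sum>i\<in>A. c i * f i (x - s)) has_integral (\<Sum>i\<in>A. c i * avg (f i) x)) {0..1}"
    using assms by (intro has_integral_sum True has_integral_mult_right has_integral_avg) auto
  then show ?thesis unfolding avg_def by (rule integral_unique)
qed (simp add: avg_def)

lemma avg_pow_sum:
  assumes "\<And>i. i \<in> A \<Longrightarrow> continuous_on UNIV (f i)"
  shows "(avg ^^ r) (\<lambda>y. \<Sum>i\<in>A. c i * f i y) = (\<lambda>x. \<Sum>i\<in>A. c i * (avg ^^ r) (f i) x)"
  by (induction r) (auto simp: avg_sum assms continuous_on_avg_pow)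

lemma avg_pow_cmult:
  assumes "continuous_on UNIV f"
  shows "(avg ^^ r) (\<lambda>y. c * f y) = (\<lambda>x. c * (avg ^^ r) f x)"
  using avg_pow_sum[of "{()}" "\<lambda>_. f" r "\<lambda>_. c"] assms by simp

lemma avg_pow_diff:
  assumes "continuous_on UNIV f" "continuous_on UNIV g"
  shows "(avg ^^ r) (\<lambda>y. f y - g y) = (\<lambda>x. (avg ^^ r) f x - (avg ^^ r) g x)"
  using avg_pow_sum[of UNIV "\<lambda>b. if b then f else g" r "\<lambda>b. if b then 1 else -1"] assms by (simp add: UNIV_bool)

lemma avg_pow_shift: "(avg ^^ r) (\<lambda>y. f (y - c)) = (\<lambda>x. (avg ^^ r) f (x - c))"
proof (induction r)
  case (Suc r)
  then show ?case by (auto simp: avg_def algebra_simps)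
qed auto

lemma avg_pow_const: "(avg ^^ r) (\<lambda>y. c) = (\<lambda>x. c)"
  by (induction r) (auto simp: avg_def)

lemma avg_pow_abs_le:
  assumes "continuous_on UNIV f" "continuous_on UNIV g" "\<And>y. y \<le> x \<Longrightarrow> \<bar>f y\<bar> \<le> g y"
  shows "\<bar>(avg ^^ r) f x\<bar> \<le> (avg ^^ r) g x"
proof -
  have "(avg ^^ r) f x \<le> (avg ^^ r) g x"
    by (rule avg_pow_mono[OF assms(1,2)]) (use assms(3) in force)
  moreover have "(avg ^^ r) (\<lambda>y. - 1 * f y) x \<le> (avg ^^ r) g x"
    by (rule avg_pow_mono) (use assms in \<open>force intro!: continuous_intros\<close>)+
  ultimately show ?thesis
    unfolding avg_pow_cmult[OF assms(1)] by simp
qed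

lemma power_max_0_deriv:
  "((\<lambda>y::real. max 0 y ^ Suc (Suc q)) has_real_derivative real (q+2) * max 0 y ^ Suc q) (at y)"
proof (cases "y = 0")
  case False
  have "((\<lambda>y::real. if 0 < y then y ^ Suc (Suc q) else 0) has_real_derivative real (q+2) * max 0 y ^ Suc q) (at y)"
  proof (cases "0 < y")
    case True
    have "((\<lambda>y::real. y ^ Suc (Suc q)) has_real_derivative real (q+2) * max 0 y ^ Suc q) (at y)"
      using True by (intro DERIV_cong[OF DERIV_power_Suc[where D = 1]]) auto
    then show ?thesis
      by (rule has_field_derivative_transform_within_open[where S = "{0<..}"]) (use True in auto)
  next
    case 2: False
    have "((\<lambda>y::real. 0) has_real_derivative real (q+2) * max 0 y ^ Suc q) (at y)"
      using 2 by simp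
    then show ?thesis
      by (rule has_field_derivative_transform_within_open[where S = "{..<0}"]) (use 2 False in auto)
  qed
  moreover have "(\<lambda>y::real. if 0 < y then y ^ Suc (Suc q) else 0) = (\<lambda>y. max 0 y ^ Suc (Suc q))"
    by (auto simp: max_def)
  ultimately show ?thesis by simp
next
  case True
  have "((\<lambda>h::real. max 0 h ^ Suc (Suc q) / h) \<longlongrightarrow> 0) (at 0)"
  proof (rule Lim_null_comparison)
    show "\<forall>\<^sub>F h in at 0. norm (max 0 h ^ Suc (Suc q) / h) \<le> (max 0 h :: real) ^ Suc q"
      by (rule always_eventually) (auto simp: max_def)
    have "((\<lambda>h::real. max 0 h ^ Suc q) \<longlongrightarrow> max 0 0 ^ Suc q) (at 0)"
      by (intro tendsto_intros)
    then show "((\<lambda>h::real. max 0 h ^ Suc q) \<longlongrightarrow> 0) (at 0)" by simp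
  qed
  then show ?thesis using True by (simp add: has_field_derivative_iff)
qed

text \<open>The mean of a derivative over a unit interval is a backward difference; iterating it gives the
  alternating sum in \<open>avg_pow_tpow\<close>.\<close>

lemma avg_tpow: "avg (tpow (Suc q)) y = tpow (q+2) y - tpow (q+2) (y - 1)"
proof -
  have "((\<lambda>s. tpow (Suc q) (y - s)) has_integral (- tpow (q+2) (y - 1) - - tpow (q+2) (y - 0))) {0..1}"
  proof (rule fundamental_theorem_of_calculus)
    fix s :: real
    have "(tpow (q+2) has_real_derivative tpow (Suc q) u) (at u)" for u
    proof -
      have "real (q+2) * max 0 u ^ Suc q / fact (q+2) = tpow (Suc q) u"
        by (simp add: tpow_def divide_simps del: power_Suc)
      then show ?thesis
        using DERIV_cdivide[OF power_max_0_deriv[of q u], of "fact (q+2)"]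
        by (simp add: tpow_def[abs_def] del: power_Suc fact_Suc)
    qed
    from DERIV_minus[OF DERIV_chain2[OF this, of "\<lambda>s. y - s" "-1" s]]
    have "((\<lambda>s. - tpow (q+2) (y - s)) has_real_derivative tpow (Suc q) (y - s)) (at s within {0..1})"
      by (rule DERIV_cong[OF has_field_derivative_at_within]) (auto intro!: derivative_eq_intros)
    then show "((\<lambda>s. - tpow (q+2) (y - s)) has_vector_derivative tpow (Suc q) (y - s)) (at s within {0..1})"
      by (simp add: has_real_derivative_iff_has_vector_derivative)
  qed auto
  then show ?thesis by (simp add: avg_def integral_unique)
qed

lemma sum_choose_Suc:
  fixes h :: "nat \<Rightarrow> real"
  shows "(\<Sum>j\<le>Suc r. real (Suc r choose j) * h j)
       = (\<Sum>j\<le>r. real (r choose j) * (h j + h (Suc j)))"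
proof -
  have "(\<Sum>j\<le>Suc r. real (Suc r choose j) * h j)
      = (\<Sum>j\<le>Suc r. real (r choose j) * h j) + (\<Sum>j\<le>r. real (r choose j) * h (Suc j))"
    by (subst (1 2) sum.atMost_Suc_shift) (simp add: sum.distrib[symmetric] algebra_simps)
  then show ?thesis by (simp add: sum.distrib[symmetric] algebra_simps)
qed

lemma sum_alternating_choose_Suc:
  fixes h :: "nat \<Rightarrow> real"
  shows "(\<Sum>j\<le>Suc r. (-1) ^ j * real (Suc r choose j) * h j)
       = (\<Sum>j\<le>r. (-1) ^ j * real (r choose j) * (h j - h (Suc j)))"
  using sum_choose_Suc[of r "\<lambda>j. (-1) ^ j * h j"] by (simp add: algebra_simps)

lemma avg_pow_tpow:
  "(avg ^^ r) (tpow (Suc q)) = (\<lambda>x. \<Sum>j\<le>r. (-1) ^ j * real (r choose j) * tpow (Suc q + r) (x - real j))"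
proof (induction r)
  case (Suc r)
  have "avg (\<lambda>x. \<Sum>j\<le>r. (-1) ^ j * real (r choose j) * tpow (Suc q + r) (x - real j)) x
     = (\<Sum>j\<le>r. (-1) ^ j * real (r choose j) * avg (\<lambda>y. tpow (Suc q + r) (y - real j)) x)" for x
    by (rule avg_sum) (intro continuous_on_compose2[OF continuous_on_tpow[of UNIV]] continuous_intros subset_UNIV)
  also have "\<dots> x = (\<Sum>j\<le>r. (-1) ^ j * real (r choose j) *
       (tpow (Suc q + Suc r) (x - real j) - tpow (Suc q + Suc r) (x - real (Suc j))))" for x
  proof -
    have "avg (\<lambda>y. tpow (Suc q + r) (y - real j)) x
        = tpow (Suc q + Suc r) (x - real j) - tpow (Suc q + Suc r) (x - real (Suc j))" for j
      using avg_pow_shift[of 1 "tpow (Suc (q + r))" "real j"] avg_tpow[of "q+r" "x - real j"]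
      by (simp add: fun_eq_iff algebra_simps)
    then show ?thesis by simp
  qed
  finally show ?case
    unfolding sum_alternating_choose_Suc by (simp only: funpow.simps o_def Suc.IH)
qed simp

section \<open>Estimating the number of separated labellings\<close>

text \<open>The Beta integral and its error in the normalization by factorials. Since \<open>D\<close> and \<open>q\<close> are at
  least \<open>d\<close>, both \<open>1 / (D - 2)\<close> and \<open>1 / (q - 1)\<close> are at most \<open>1 / (d - 2)\<close>.\<close>

lemma tpow_sum_error:
  fixes s T :: real and d D q K :: nat
  assumes s: "0 \<le> s" "s \<le> 1" and T: "T \<le> real K - s" and d: "3 \<le> d" "d \<le> D" "d \<le> q"
  shows "\<bar>(\<Sum>k=1..K. real D * (real k - s) ^ (D - 1) * tpow q (T - (real k - s))) - fact D * tpow (D + q) T\<bar>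
         \<le> 1 / (4 * (real d - 2)) * (fact D * tpow (D + q - 2) T)"
proof (cases "0 < T")
  case False
  have "tpow q (T - (real k - s)) = 0" if "k \<in> {1..K}" for k
    using that False s d by (intro tpow_eq_0) auto
  moreover have "tpow (D + q) T = 0" "tpow (D + q - 2) T = 0"
    using False d by (auto intro!: tpow_eq_0)
  ultimately show ?thesis by simp
next
  case True
  define a where "a = D - 3"
  define b where "b = q - 2"
  have a: "D = a + 3" and b: "q = b + 2" using d by (auto simp: a_def b_def)
  let ?B = "\<Sum>k=1..K. bump T (a+2) (b+2) (real k - s)"
  have summand: "tpow q (T - (real k - s)) * (real k - s) ^ (D - 1) = bump T (a+2) (b+2) (real k - s) / fact q"
    if "k \<in> {1..K}" for k
    using that s unfolding a b tpow_def bump_def by (auto simp: max_def power_0_left)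
  have sum: "(\<Sum>k=1..K. real D * (real k - s) ^ (D - 1) * tpow q (T - (real k - s))) = real D / fact q * ?B"
    unfolding sum_distrib_left using summand by (intro sum.cong) (auto simp: mult_ac)
  have f: "fact D = real D * fact (a+2)" proof -
    have "D = Suc (a + 2)" by (simp add: a)
    then show ?thesis by (simp only: fact_Suc)
  qed
  have m1: "fact D * tpow (D + q) T = real D / fact q * (fact (a+2) * fact (b+2) / fact (a+b+5) * T ^ (a+b+5))"
    using True unfolding tpow_def f by (simp add: a b max_def add_ac del: fact_Suc)
  have m2: "fact D * tpow (D + q - 2) T = real D / fact q * (fact (a+2) * fact (b+2) / fact (a+b+3) * T ^ (a+b+3))"
    using True unfolding tpow_def f by (simp add: a b max_def add_ac del: fact_Suc)
  have "1 / real (a+1) \<le> 1 / (real d - 2)" "1 / real (b+1) \<le> 1 / (real d - 2)"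
    using d by (auto simp: a b intro!: divide_left_mono)
  moreover have "1 / (4 * (real d - 2)) = 1 / (real d - 2) / 4"
    by simp
  moreover have "(u + v) / 8 \<le> w / 4" if "u \<le> w" "v \<le> w" for u v w :: real
    using that by simp
  ultimately have c: "(1 / real (a+1) + 1 / real (b+1)) / 8 \<le> 1 / (4 * (real d - 2))"
    by metis
  have "\<bar>(\<Sum>k=1..K. real D * (real k - s) ^ (D - 1) * tpow q (T - (real k - s))) - fact D * tpow (D + q) T\<bar>
      = real D / fact q * \<bar>?B - fact (a+2) * fact (b+2) / fact (a+b+5) * T ^ (a+b+5)\<bar>"
    unfolding sum m1 right_diff_distrib[symmetric] abs_mult by simp
  also have "\<dots> \<le> real D / fact q * ((1 / real (a+1) + 1 / real (b+1)) / 8 *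
         (fact (a+2) * fact (b+2) / fact (a+b+3) * T ^ (a+b+3)))"
    using bump_sum_error[OF s(1) _ T, of a b] True by (intro mult_left_mono) auto
  also have "\<dots> = (1 / real (a+1) + 1 / real (b+1)) / 8 * (fact D * tpow (D + q - 2) T)"
    unfolding m2 by (simp only: mult_ac)
  also have "\<dots> \<le> 1 / (4 * (real d - 2)) * (fact D * tpow (D + q - 2) T)"
    by (intro mult_right_mono c) (simp add: tpow_nonneg)
  finally show ?thesis .
qed

lemma power_diff_has_integral:
  "0 < D \<Longrightarrow> ((\<lambda>s. real D * (x - s) ^ (D - 1)) has_integral (x ^ D - (x - 1) ^ D)) {0..1}" for x :: real
proof -
  assume "0 < D"
  then obtain b where b: "D = Suc b" using gr0_implies_Suc by blast
  have "((\<lambda>s. - ((x - s) ^ Suc b)) has_real_derivative real D * (x - s) ^ (D - 1)) (at s within {0..1})" for s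
    using DERIV_minus[OF DERIV_power_Suc_diff[of x b s "{0..1}"]] by (simp add: b del: power_Suc of_nat_Suc)
  from fundamental_theorem_of_calculus[OF zero_le_one this[THEN has_real_derivative_iff_has_vector_derivative[THEN iffD1]]]
  show ?thesis by (simp add: b del: power_Suc of_nat_Suc)
qed


text \<open>With \<open>k ^ D - (k - 1) ^ D\<close> written as an integral over \<open>s\<close>, each \<open>s\<close> contributes the
  sum of the previous lemma at \<open>T = y - s\<close>, because \<open>y - k = T - (k - s)\<close>. That bound is uniform in \<open>s\<close> and can be integrated.\<close>

lemma power_diff_sum_error:
  fixes y :: real
  assumes y: "y \<le> real K" and d: "3 \<le> d" "d \<le> D" "d \<le> q"
  shows "\<bar>(\<Sum>k=1..K. (real k ^ D - (real k - 1) ^ D) * tpow q (y - real k)) - fact D * avg (tpow (D + q)) y\<bar>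
         \<le> 1 / (4 * (real d - 2)) * fact D * avg (tpow (D + q - 2)) y"
proof -
  note c = continuous_on_tpow[of UNIV]
  let ?f = "\<lambda>s. (\<Sum>k=1..K. real D * (real k - s) ^ (D - 1) * tpow q (y - real k)) - fact D * tpow (D + q) (y - s)"
  let ?I = "(\<Sum>k=1..K. (real k ^ D - (real k - 1) ^ D) * tpow q (y - real k)) - fact D * avg (tpow (D + q)) y"
  let ?g = "\<lambda>s. 1 / (4 * (real d - 2)) * fact D * tpow (D + q - 2) (y - s)"
  let ?J = "1 / (4 * (real d - 2)) * fact D * avg (tpow (D + q - 2)) y"
  have f: "(?f has_integral ?I) {0..1}"
    using d by (intro has_integral_diff has_integral_sum has_integral_mult_left
        has_integral_mult_right power_diff_has_integral has_integral_avg c) auto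
  have g: "(?g has_integral ?J) {0..1}"
    by (intro has_integral_mult_right has_integral_avg c)
  have fg: "\<bar>?f s\<bar> \<le> ?g s" if "s \<in> {0..1}" for s
    using that y tpow_sum_error[of s "y - s" K d D q] d by (simp add: mult_ac)
  have "?I \<le> ?J" using f g by (rule has_integral_le) (use fg in force)
  moreover have "- ?J \<le> ?I"
    using has_integral_neg[OF g] f by (rule has_integral_le) (use fg in force)
  ultimately show ?thesis by linarith
qed

text \<open>The term \<open>i = 0\<close> is the main term of \<open>sep_count_error\<close>; the other terms collect the errors, where \<open>i\<close>
  is the number of convolutions at which the error was taken instead of the main term.\<close>

definition err_bound :: "real \<Rightarrow> nat \<Rightarrow> nat \<Rightarrow> real \<Rightarrow> real" where
  "err_bound \<mu> r N x = (\<Sum>i\<le>r. real (r choose i) * (\<mu> ^ i * (avg ^^ r) (tpow (N - 2 * i)) x))"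

lemma avg_pow_power_diff_sum_error:
  assumes d: "3 \<le> d" "d \<le> D" "d \<le> q"
  shows "\<bar>(\<Sum>k=1..K. (real k ^ D - (real k - 1) ^ D) * (avg ^^ r) (tpow q) (real K - real k)) - fact D * (avg ^^ Suc r) (tpow (D + q)) (real K)\<bar>
         \<le> 1 / (4 * (real d - 2)) * fact D * (avg ^^ Suc r) (tpow (D + q - 2)) (real K)"
proof -
  note c = continuous_on_tpow[of UNIV]
  have cs: "continuous_on UNIV (\<lambda>y. tpow n (y - c))" for n c
    by (intro continuous_on_compose2[OF c] continuous_intros) auto
  let ?S = "\<lambda>y. \<Sum>k=1..K. (real k ^ D - (real k - 1) ^ D) * tpow q (y - real k)"
  have cS: "continuous_on UNIV ?S"
    by (intro continuous_on_sum continuous_on_mult continuous_on_const cs)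
  have cM: "continuous_on UNIV (\<lambda>y. a * avg (tpow n) y)" for a n
    by (intro continuous_intros continuous_on_avg c)
  have "\<bar>(avg ^^ r) (\<lambda>y. ?S y - fact D * avg (tpow (D + q)) y) (real K)\<bar>
     \<le> (avg ^^ r) (\<lambda>y. 1 / (4 * (real d - 2)) * fact D * avg (tpow (D + q - 2)) y) (real K)"
    by (rule avg_pow_abs_le) (intro continuous_on_diff cS cM power_diff_sum_error d)+
  then show ?thesis
    by (simp only: avg_pow_diff[OF cS cM] avg_pow_sum[OF cs] avg_pow_shift
        avg_pow_cmult[OF continuous_on_avg[OF c]] funpow_Suc_right o_def)
qed

text \<open>Induction over the blocks. Convolving one more block maps each term of the bound to a main term and an
  error term whose exponent is smaller by two, so the coefficients follow Pascal's rule. Throughout, the exponents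
  \<open>N - 2 * i\<close> stay at least \<open>d\<close>, as each block adds at least \<open>d\<close> and loses at most two.\<close>

lemma sep_count_error:
  assumes "3 \<le> d" "Ds \<noteq> []" "\<forall>D\<in>set Ds. d \<le> D"
  defines "\<mu> \<equiv> 1 / (4 * (real d - 2))"
  shows "\<bar>sep_count Ds x - prod_list (map fact Ds) * (avg ^^ (length Ds - 1)) (tpow (sum_list Ds)) (real x)\<bar>
    \<le> prod_list (map fact Ds) * (err_bound \<mu> (length Ds - 1) (sum_list Ds) (real x) -
         (avg ^^ (length Ds - 1)) (tpow (sum_list Ds)) (real x))"
  using assms(2,3)
proof (induction Ds arbitrary: x)
  case (Cons D Ds)
  show ?case
  proof (cases "Ds = []")
    case True
    then show ?thesis by (simp add: err_bound_def tpow_def)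
  next
    case False
    define r where "r = length Ds - 1"
    define N where "N = sum_list Ds"
    define \<Phi> where "\<Phi> = (prod_list (map fact Ds) :: real)"
    define w where "w k = real k ^ D - (real k - 1) ^ D" for k
    define a where "a n y = (avg ^^ r) (tpow n) y" for n y
    define A where "A n = (avg ^^ Suc r) (tpow n) (real x)" for n
    have len: "length Ds = Suc r" using False by (simp add: r_def)
    have D: "d \<le> D" using Cons.prems by simp
    have w: "0 \<le> w k" if "1 \<le> k" for k
      using that by (auto simp: w_def intro: power_mono)
    have \<Phi>: "0 < \<Phi>"
    proof -
      have "0 < prod_list (map fact xs :: real list)" for xs by (induction xs) auto
      then show ?thesis by (simp add: \<Phi>_def)
    qed
    have "length xs * d \<le> sum_list xs" if "\<forall>D\<in>set xs. d \<le> D" for xs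
      using that by (induction xs) auto
    from this[of Ds] Cons.prems have Nd: "Suc r * d \<le> N" by (simp add: N_def len)
    have q: "d \<le> N - 2 * i" if "i \<le> r" for i
    proof -
      have "2 * i \<le> r * d" using that assms(1) mult_le_mono[of i r 2 d] by (simp add: mult.commute)
      then show ?thesis using Nd by simp
    qed
    have step: "\<bar>(\<Sum>k=1..x. w k * a n (real x - real k)) - fact D * A (D + n)\<bar> \<le> \<mu> * fact D * A (D + n - 2)" if "d \<le> n" for n
      unfolding a_def A_def w_def \<mu>_def by (rule avg_pow_power_diff_sum_error[OF assms(1) D that])
    have IH: "\<bar>sep_count Ds (x - k) - \<Phi> * a N (real x - real k)\<bar> \<le> \<Phi> * ((\<Sum>i\<le>r. real (r choose i) * (\<mu> ^ i * a (N - 2 * i) (real x - real k))) - a N (real x - real k))"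
      if "k \<in> {1..x}" for k
      using Cons.IH[of "x - k"] False Cons.prems that
      by (simp add: \<Phi>_def N_def a_def err_bound_def of_nat_diff r_def)
    have "\<mu> \<ge> 0" using assms(1) by (simp add: \<mu>_def)
    \<comment> \<open>First the error inherited from \<open>Ds\<close>, then (in 3) the new error made in convolving the main term.\<close>
    let ?W = "\<lambda>n. \<Sum>k=1..x. w k * a n (real x - real k)"
    have "\<bar>(\<Sum>k=1..x. w k * sep_count Ds (x - k)) - \<Phi> * ?W N\<bar>
       = \<bar>\<Sum>k=1..x. w k * (sep_count Ds (x - k) - \<Phi> * a N (real x - real k))\<bar>"
      by (simp add: sum_distrib_left sum_subtractf algebra_simps)
    also have "\<dots> \<le> (\<Sum>k=1..x. w k * \<bar>sep_count Ds (x - k) - \<Phi> * a N (real x - real k)\<bar>)"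
      by (rule order_trans[OF sum_abs]) (simp add: abs_mult w)
    also have "\<dots> \<le> (\<Sum>k=1..x. w k * (\<Phi> * ((\<Sum>i\<le>r. real (r choose i) * (\<mu> ^ i * a (N - 2 * i) (real x - real k))) - a N (real x - real k))))"
      by (intro sum_mono mult_left_mono IH w) auto
    also have "\<dots> = \<Phi> * ((\<Sum>k=1..x. w k * (\<Sum>i\<le>r. real (r choose i) * (\<mu> ^ i * a (N - 2 * i) (real x - real k)))) - ?W N)"
      by (simp add: sum_distrib_left sum_subtractf algebra_simps)
    also have "(\<Sum>k=1..x. w k * (\<Sum>i\<le>r. real (r choose i) * (\<mu> ^ i * a (N - 2 * i) (real x - real k))))
       = (\<Sum>i\<le>r. real (r choose i) * (\<mu> ^ i * ?W (N - 2 * i)))"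
      unfolding sum_distrib_left by (subst sum.swap) (simp add: mult_ac)
    finally have 1: "\<bar>(\<Sum>k=1..x. w k * sep_count Ds (x - k)) - \<Phi> * ?W N\<bar>
       \<le> \<Phi> * ((\<Sum>i\<le>r. real (r choose i) * (\<mu> ^ i * ?W (N - 2 * i))) - ?W N)" .
    \<comment> \<open>The term \<open>i = 0\<close> cancels exactly on both sides and must be split off before estimating termwise.\<close>
    have rest: "(\<Sum>i\<le>r. real (r choose i) * h i) - h 0 = (\<Sum>i=1..r. real (r choose i) * h i)" for h
      by (simp add: atMost_atLeast0 sum.atLeast_Suc_atMost)
    have U: "?W n \<le> fact D * (A (D + n) + \<mu> * A (D + n - 2))" if "d \<le> n" for n
      using step[OF that] by (simp add: algebra_simps)
    have 2: "(\<Sum>i\<le>r. real (r choose i) * (\<mu> ^ i * ?W (N - 2 * i))) - ?W N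
      \<le> (\<Sum>i\<le>r. real (r choose i) * (\<mu> ^ i * (fact D * (A (D + (N - 2 * i)) + \<mu> * A (D + (N - 2 * i) - 2)))))
         - fact D * (A (D + N) + \<mu> * A (D + N - 2))"
      using rest[of "\<lambda>i. \<mu> ^ i * ?W (N - 2 * i)"]
        rest[of "\<lambda>i. \<mu> ^ i * (fact D * (A (D + (N - 2 * i)) + \<mu> * A (D + (N - 2 * i) - 2)))"]
        sum_mono[of "{1..r}" "\<lambda>i. real (r choose i) * (\<mu> ^ i * ?W (N - 2 * i))"
          "\<lambda>i. real (r choose i) * (\<mu> ^ i * (fact D * (A (D + (N - 2 * i)) + \<mu> * A (D + (N - 2 * i) - 2))))"]
      using \<open>0 \<le> \<mu>\<close> q U by (simp add: mult_left_mono)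
    have 3: "\<bar>\<Phi> * ?W N - \<Phi> * (fact D * A (D + N))\<bar> \<le> \<Phi> * (\<mu> * fact D * A (D + N - 2))"
      using step[OF q[of 0]] \<Phi> unfolding right_diff_distrib[symmetric] abs_mult by simp
    have 4: "(\<Sum>i\<le>r. real (r choose i) * (\<mu> ^ i * (fact D * (A (D + (N - 2 * i)) + \<mu> * A (D + (N - 2 * i) - 2)))))
       = fact D * err_bound \<mu> (Suc r) (D + N) (real x)"
    proof -
      have "err_bound \<mu> (Suc r) (D + N) (real x) = (\<Sum>i\<le>r. real (r choose i) * (\<mu> ^ i * A (D + N - 2 * i) + \<mu> ^ Suc i * A (D + N - 2 * Suc i)))"
        unfolding err_bound_def sum_choose_Suc A_def ..
      also have "\<dots> = (\<Sum>i\<le>r. real (r choose i) * (\<mu> ^ i * (A (D + (N - 2 * i)) + \<mu> * A (D + (N - 2 * i) - 2))))"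
      proof (rule sum.cong)
        fix i assume "i \<in> {..r}"
        then have "2 * i \<le> N" using q[of i] assms(1) by auto
        then have "D + N - 2 * i = D + (N - 2 * i)" "D + N - 2 * Suc i = D + (N - 2 * i) - 2" by auto
        then show "real (r choose i) * (\<mu> ^ i * A (D + N - 2 * i) + \<mu> ^ Suc i * A (D + N - 2 * Suc i))
          = real (r choose i) * (\<mu> ^ i * (A (D + (N - 2 * i)) + \<mu> * A (D + (N - 2 * i) - 2)))"
          by (simp only: power_Suc) (simp add: algebra_simps)
      qed simp
      finally show ?thesis by (simp add: sum_distrib_left mult_ac)
    qed
    have 5: "sep_count (D # Ds) x = (\<Sum>k=1..x. w k * sep_count Ds (x - k))"
      using False by (simp add: w_def)
    have "\<Phi> * ((\<Sum>i\<le>r. real (r choose i) * (\<mu> ^ i * ?W (N - 2 * i))) - ?W N)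
       \<le> \<Phi> * (fact D * err_bound \<mu> (Suc r) (D + N) (real x) - fact D * (A (D + N) + \<mu> * A (D + N - 2)))"
      using 2 \<Phi> unfolding 4 by (intro mult_left_mono) auto
    with 1 3 have "\<bar>sep_count (D # Ds) x - \<Phi> * (fact D * A (D + N))\<bar>
      \<le> \<Phi> * (fact D * err_bound \<mu> (Suc r) (D + N) (real x) - fact D * (A (D + N) + \<mu> * A (D + N - 2))) + \<Phi> * (\<mu> * fact D * A (D + N - 2))"
      unfolding 5 by linarith
    also have "\<dots> = \<Phi> * fact D * (err_bound \<mu> (Suc r) (D + N) (real x) - A (D + N))"
      by (simp add: algebra_simps)
    finally show ?thesis
      by (simp add: len \<Phi>_def N_def A_def mult_ac del: funpow.simps)
  qed
qed simp

text \<open>Where \<open>y \<ge> T\<close>, replacing \<open>y ^ N / N!\<close> by \<open>y ^ (N - 2 * i) / (N - 2 * i)!\<close> costs at most the factor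
  \<open>(N\<^sup>2 / T\<^sup>2) ^ i\<close>. The binomial theorem then sums the error terms. The factor \<open>1/4\<close> from the trapezoid rule
  is weakened to \<open>1/3\<close> at the end.\<close>

lemma sep_count_relative_error:
  assumes d: "3 \<le> d" and Ds: "Ds \<noteq> []" "\<forall>D\<in>set Ds. d \<le> D" "length Ds \<le> x"
  defines "r \<equiv> length Ds - 1" and "N \<equiv> sum_list Ds"
  obtains \<eta> where
    "sep_count Ds x = (1 + \<eta>) * (prod_list (map fact Ds) * (avg ^^ r) (tpow N) (real x))"
    "\<bar>\<eta>\<bar> \<le> (1 + (real N)\<^sup>2 / (3 * (real d - 2) * (real x - real r)\<^sup>2)) ^ r - 1"
proof -
  define \<mu> where "\<mu> = 1 / (4 * (real d - 2))"
  define T where "T = real x - real r"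
  define M where "M = (avg ^^ r) (tpow N) (real x)"
  define \<Phi> where "\<Phi> = (prod_list (map fact Ds) :: real)"
  define \<rho> where "\<rho> = (real N)\<^sup>2 / T\<^sup>2"
  note c = continuous_on_tpow[of UNIV]
  have \<Phi>: "0 < \<Phi>"
  proof -
    have "0 < prod_list (map fact xs :: real list)" for xs by (induction xs) auto
    then show ?thesis by (simp add: \<Phi>_def)
  qed
  have len: "length Ds = Suc r" using Ds(1) by (simp add: r_def)
  have T: "1 \<le> T" using Ds(3) by (simp add: T_def len)
  have "length xs * d \<le> sum_list xs" if "\<forall>D\<in>set xs. d \<le> D" for xs
    using that by (induction xs) auto
  from this[of Ds] Ds(2) have Nd: "Suc r * d \<le> N" by (simp add: N_def len)
  have M: "0 < M"
  proof -
    have "(avg ^^ r) (\<lambda>_. 1 / fact N) (real x) \<le> M"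
      unfolding M_def
    proof (rule avg_pow_mono)
      fix y assume "real x - real r \<le> y"
      then have "1 \<le> y" using T by (simp add: T_def)
      then show "1 / fact N \<le> tpow N y" by (simp add: tpow_def divide_right_mono max_def)
    qed (simp_all add: c)
    then show ?thesis by (simp add: avg_pow_const less_le_trans[rotated])
  qed
  have bound: "(avg ^^ r) (tpow (N - 2 * i)) (real x) \<le> \<rho> ^ i * M" if i: "i \<le> r" for i
  proof -
    have iN: "2 * i \<le> N" using i Nd d mult_le_mono[of i r 2 d] by (simp add: mult.commute)
    have "(avg ^^ r) (tpow (N - 2 * i)) (real x) \<le> (avg ^^ r) (\<lambda>y. \<rho> ^ i * tpow N y) (real x)"
    proof (rule avg_pow_mono)
      fix y assume "real x - real r \<le> y"
      then have y: "T \<le> y" by (simp add: T_def)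
      have "(fact N :: nat) \<le> fact (N - 2 * i) * N ^ (2 * i)"
      proof -
        have "(fact N :: nat) = fact (N - 2 * i) * (fact N div fact (N - 2 * i))"
          by (simp add: fact_dvd dvd_mult_div_cancel)
        also have "\<dots> \<le> fact (N - 2 * i) * N ^ (2 * i)"
          by (intro mult_left_mono fact_div_fact_le_pow iN) simp
        finally show ?thesis .
      qed
      then have f: "(fact N :: real) \<le> fact (N - 2 * i) * real N ^ (2 * i)"
        using of_nat_mono[of "fact N" "fact (N - 2 * i) * N ^ (2 * i)", where 'a = real] by simp
      have "T ^ (2 * i) \<le> y ^ (2 * i)" using y T by (intro power_mono) auto
      then have "fact N * T ^ (2 * i) * y ^ (N - 2 * i)
          \<le> (fact (N - 2 * i) * real N ^ (2 * i)) * y ^ (2 * i) * y ^ (N - 2 * i)"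
        using T y f by (intro mult_mono) auto
      also have "\<dots> = fact (N - 2 * i) * real N ^ (2 * i) * y ^ N"
      proof -
        have "y ^ (2 * i) * y ^ (N - 2 * i) = y ^ N"
          using iN by (simp only: power_add[symmetric] le_add_diff_inverse)
        then show ?thesis by (simp only: mult.assoc)
      qed
      finally have "y ^ (N - 2 * i) / fact (N - 2 * i) \<le> real N ^ (2 * i) / T ^ (2 * i) * (y ^ N / fact N)"
      proof -
        have "v / F \<le> A / B * (Y / G)" if "G * B * v \<le> F * A * Y" "0 < B" "0 < F" "0 < G" for v F G A B Y :: real
          using that by (simp add: field_simps)
        moreover assume "fact N * T ^ (2 * i) * y ^ (N - 2 * i) \<le> fact (N - 2 * i) * real N ^ (2 * i) * y ^ N"
        ultimately show ?thesis using T by simp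
      qed
      then show "tpow (N - 2 * i) y \<le> \<rho> ^ i * tpow N y"
        using T y by (simp add: tpow_def \<rho>_def max_def power_divide power_mult)
    qed (auto intro!: c continuous_intros)
    then show ?thesis by (simp add: avg_pow_cmult[OF c] M_def)
  qed
  have \<mu>: "0 \<le> \<mu>" using d by (simp add: \<mu>_def)
  have "err_bound \<mu> r N (real x) \<le> (\<Sum>i\<le>r. real (r choose i) * (\<mu> ^ i * (\<rho> ^ i * M)))"
    unfolding err_bound_def using bound \<mu> by (intro sum_mono mult_left_mono) auto
  also have "\<dots> = (\<mu> * \<rho> + 1) ^ r * M"
    by (simp add: binomial_ring sum_distrib_left sum_distrib_right power_mult_distrib mult_ac)
  finally have err: "err_bound \<mu> r N (real x) \<le> (\<mu> * \<rho> + 1) ^ r * M" .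
  have "\<bar>sep_count Ds x - \<Phi> * M\<bar> \<le> \<Phi> * (err_bound \<mu> r N (real x) - M)"
    using sep_count_error[OF d Ds(1,2), of x] unfolding \<mu>_def r_def N_def M_def \<Phi>_def .
  also have "\<dots> \<le> \<Phi> * ((\<mu> * \<rho> + 1) ^ r * M - M)"
    using \<Phi> err by simp
  finally have abs: "\<bar>sep_count Ds x - \<Phi> * M\<bar> \<le> \<Phi> * M * ((\<mu> * \<rho> + 1) ^ r - 1)"
    by (simp add: algebra_simps)
  define \<eta> where "\<eta> = sep_count Ds x / (\<Phi> * M) - 1"
  have pos: "0 < \<Phi> * M" using \<Phi> M by simp
  have \<eta>: "sep_count Ds x - \<Phi> * M = \<Phi> * M * \<eta>"
    using \<Phi> M by (simp add: \<eta>_def right_diff_distrib)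
  have "\<Phi> * M * \<bar>\<eta>\<bar> \<le> \<Phi> * M * ((\<mu> * \<rho> + 1) ^ r - 1)"
    using abs pos unfolding \<eta> abs_mult[of "\<Phi> * M"] by (simp only: abs_of_pos)
  then have "\<bar>\<eta>\<bar> \<le> (\<mu> * \<rho> + 1) ^ r - 1"
    using pos by (simp only: mult_le_cancel_left_pos)
  also have "\<dots> \<le> (1 + (real N)\<^sup>2 / (3 * (real d - 2) * T\<^sup>2)) ^ r - 1"
  proof -
    have "\<mu> \<le> 1 / (3 * (real d - 2))" using d by (simp add: \<mu>_def divide_simps)
    then have "\<mu> * \<rho> \<le> 1 / (3 * (real d - 2)) * \<rho>" by (intro mult_right_mono) (simp_all add: \<rho>_def)
    then have "\<mu> * \<rho> + 1 \<le> 1 + (real N)\<^sup>2 / (3 * (real d - 2) * T\<^sup>2)" by (simp add: \<rho>_def)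
    moreover have "0 \<le> \<mu> * \<rho> + 1" using \<mu> by (simp add: \<rho>_def)
    ultimately show ?thesis by (simp add: power_mono)
  qed
  finally have "\<bar>\<eta>\<bar> \<le> (1 + (real N)\<^sup>2 / (3 * (real d - 2) * (real x - real r)\<^sup>2)) ^ r - 1"
    by (simp add: T_def)
  moreover have "sep_count Ds x = (1 + \<eta>) * (\<Phi> * M)"
    using \<eta> by (simp add: algebra_simps)
  ultimately show ?thesis
    using that unfolding \<Phi>_def M_def by blast
qed

section \<open>The separation distance\<close>

lemma prod_add_eq_fact: "(\<Prod>i=1..r. real n + real i) = fact (n + r) / fact n"
proof (induction r)
  case (Suc r)
  have "fact (n + Suc r) = fact (n + r) * (real n + real (Suc r))"
    by (simp add: mult.commute)
  then have "fact (n + Suc r) / fact n = fact (n + r) / fact n * (real n + real (Suc r))"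
    by (simp only: times_divide_eq_left)
  then show ?case by (simp only: prod.nat_ivl_Suc' le_add1 Suc_eq_plus1 flip: Suc.IH) (simp add: mult.commute)
qed simp

text \<open>For \<open>r \<le> a\<close> the truncation in \<open>avg_pow_tpow\<close> is inactive, and factoring out powers of \<open>a\<close> gives the form of the main term.\<close>

lemma avg_pow_tpow_closed_form:
  assumes "0 < n" "r \<le> a" "0 < a"
  shows "real a ^ r / (\<Prod>i=1..r. real n + real i)
      * (\<Sum>j=0..r. (-1) ^ j * real (r choose j) * (1 - real j / real a) ^ (n + r))
    = fact n / real a ^ n * (avg ^^ r) (tpow n) (real a)"
proof -
  obtain q where q: "n = Suc q" using assms(1) gr0_implies_Suc by blast
  have "(avg ^^ r) (tpow n) (real a) = (\<Sum>j=0..r. (-1) ^ j * real (r choose j) * ((real a - real j) ^ (n + r) / fact (n + r)))"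
    unfolding q avg_pow_tpow atMost_atLeast0
    using assms(2) by (intro sum.cong) (auto simp: tpow_def simp del: power_Suc fact_Suc)
  also have "\<dots> = real a ^ (n + r) / fact (n + r) * (\<Sum>j=0..r. (-1) ^ j * real (r choose j) * (1 - real j / real a) ^ (n + r))"
    unfolding sum_distrib_left
  proof (rule sum.cong)
    fix j
    have "real a - real j = real a * (1 - real j / real a)" using assms(3) by (simp add: field_simps)
    then show "(-1) ^ j * real (r choose j) * ((real a - real j) ^ (n + r) / fact (n + r))
       = real a ^ (n + r) / fact (n + r) * ((-1) ^ j * real (r choose j) * (1 - real j / real a) ^ (n + r))"
      by (simp only: power_mult_distrib) simp
  qed simp
  finally show ?thesis
    unfolding prod_add_eq_fact using assms(3) by (simp add: power_add)
qed

theorem theorem1p1: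
  fixes m k d n :: nat and D :: "nat \<Rightarrow> nat"
  assumes "m \<ge> 1" and "k \<ge> 1" and "d \<ge> 3"
    and "\<forall>i\<in>{1..m}. D i \<ge> d"
    and "n = (\<Sum>i=1..m. D i)"
    and "(2::real) ^ k \<noteq> real m - 1"
  shows "\<exists>\<eta>::real.
      separation_distance m D k =
        1 - (1 + \<eta>) * (2 ^ (k * (m - 1)) / (\<Prod>i=1..m-1. real n + real i))
              * (\<Sum>j=0..m-1. (-1) ^ j * real ((m - 1) choose j)
                    * (1 - real j / 2 ^ k) ^ (n + m - 1))
      \<and> \<bar>\<eta>\<bar> \<le> (1 + (real n)\<^sup>2 / (3 * (real d - 2) * (2 ^ k - real m + 1)\<^sup>2)) ^ (m - 1) - 1"
proof -
  define Ds where "Ds = map D [1..<m+1]"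
  define a where "a = (2::nat) ^ k"
  have a: "0 < a" and ra: "real a = 2 ^ k" by (simp_all add: a_def)
  have Ds: "Ds \<noteq> []" "length Ds = m" "\<forall>D\<in>set Ds. d \<le> D"
    using assms(1,4) by (auto simp: Ds_def)
  have sum: "sum_list Ds = n"
    by (simp only: Ds_def assms(5) interv_sum_list_conv_sum_set_nat set_upt Suc_eq_plus1[symmetric] atLeastLessThanSuc_atLeastAtMost)
  have prod: "prod_list (map fact Ds) = (\<Prod>i=1..m. fact (D i) :: real)"
    using prod.distinct_set_conv_list[of "[1..<m+1]" "\<lambda>i. fact (D i) :: real"]
    by (simp add: Ds_def o_def atLeastLessThanSuc_atLeastAtMost del: upt_Suc)
  have "length xs * d \<le> sum_list xs" if "\<forall>D\<in>set xs. d \<le> D" for xs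
    using that by (induction xs) auto
  from this[of Ds] Ds have md: "m * d \<le> n" by (simp add: sum)
  have sep: "separation_distance m D k = 1 - sep_count Ds a / real a ^ n / uniform_prob m D"
  proof -
    have "\<forall>i\<in>{1..m}. 0 < D i" using assms(3,4) by fastforce
    from separation_distance_eq[OF assms(1) this assms(5)] show ?thesis
      by (simp add: Ds_def a_def del: upt_Suc)
  qed
  show ?thesis
  proof (cases "m \<le> a")
    case True
    obtain \<eta> where \<eta>: "sep_count Ds a = (1 + \<eta>) * (prod_list (map fact Ds) * (avg ^^ (m - 1)) (tpow n) (real a))"
      "\<bar>\<eta>\<bar> \<le> (1 + (real n)\<^sup>2 / (3 * (real d - 2) * (real a - real (m - 1))\<^sup>2)) ^ (m - 1) - 1"
    proof (rule sep_count_relative_error[OF assms(3) Ds(1,3)])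
      show "length Ds \<le> a" using True Ds(2) by simp
    qed (simp only: Ds(2) sum)
    have "0 < n" using md assms(1,3) by (auto intro: gr0I)
    from avg_pow_tpow_closed_form[OF this _ a, of "m - 1"] True
    have cf: "2 ^ (k * (m - 1)) / (\<Prod>i=1..m-1. real n + real i)
      * (\<Sum>j=0..m-1. (-1) ^ j * real (m - 1 choose j) * (1 - real j / 2 ^ k) ^ (n + m - 1))
      = fact n / real a ^ n * (avg ^^ (m - 1)) (tpow n) (real a)"
    proof -
      assume h: "m - 1 \<le> a \<Longrightarrow> real a ^ (m - 1) / (\<Prod>i=1..m-1. real n + real i)
          * (\<Sum>j=0..m-1. (-1) ^ j * real (m - 1 choose j) * (1 - real j / real a) ^ (n + (m - 1)))
        = fact n / real a ^ n * (avg ^^ (m - 1)) (tpow n) (real a)" "m \<le> a"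
      have "n + (m - 1) = n + m - 1" using assms(1) by simp
      moreover have "2 ^ (k * (m - 1)) = real a ^ (m - 1)" by (simp only: ra power_mult)
      moreover have "m - 1 \<le> a" using h(2) by simp
      ultimately show ?thesis using h(1) by (simp only: ra)
    qed
    have "0 < prod_list (map fact xs :: real list)" for xs by (induction xs) auto
    then have pos: "0 < (prod_list (map fact Ds) :: real)" .
    have U: "uniform_prob m D = prod_list (map fact Ds) / fact n"
      by (simp add: uniform_prob_def prod assms(5))
    have "sep_count Ds a / real a ^ n / uniform_prob m D = (1 + \<eta>) * (fact n / real a ^ n * (avg ^^ (m - 1)) (tpow n) (real a))"
    proof -
      have "(1 + \<eta>) * (F * M) / A / (F / N) = (1 + \<eta>) * (N / A * M)"
        if "0 < F" for F M A N :: real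
        using that by simp
      from this[OF pos] show ?thesis unfolding U \<eta>(1) .
    qed
    then have "separation_distance m D k = 1 - (1 + \<eta>) * (2 ^ (k * (m - 1)) / (\<Prod>i=1..m-1. real n + real i))
              * (\<Sum>j=0..m-1. (-1) ^ j * real ((m - 1) choose j) * (1 - real j / 2 ^ k) ^ (n + m - 1))"
      unfolding sep cf[symmetric] by (simp only: mult.assoc)
    moreover have "real a - real (m - 1) = 2 ^ k - real m + 1"
      using assms(1) by (simp add: ra of_nat_diff)
    ultimately show ?thesis using \<eta>(2) by (intro exI[of _ \<eta>] conjI) (simp_all only:)
  next
    case False
    then have "sep_count Ds a = 0"
      using Ds assms(3) by (intro sep_count_eq_0) auto
    then have "separation_distance m D k = 1" by (simp add: sep)
    moreover have "\<bar>-1\<bar> \<le> (1 + (real n)\<^sup>2 / (3 * (real d - 2) * (2 ^ k - real m + 1)\<^sup>2)) ^ (m - 1) - 1"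
    proof -
      let ?x = "(real n)\<^sup>2 / (3 * (real d - 2) * (2 ^ k - real m + 1)\<^sup>2)"
      let ?t = "2 ^ k - real m + 1"
      have "real a < real m" using False by simp
      then have "(2::real) ^ k < real m" by (simp only: ra)
      moreover have "0 < (2::real) ^ k" by simp
      ultimately have "\<bar>?t\<bar> \<le> real m"
        using of_nat_mono[OF assms(1), where 'a = real, unfolded of_nat_1] by linarith
      then have t: "?t\<^sup>2 \<le> (real m)\<^sup>2" by (simp add: abs_le_square_iff[symmetric])
      have "0 \<le> (real d - 3/2)\<^sup>2" by simp
      then have "3 * (real d - 2) \<le> (real d)\<^sup>2" by (simp add: power2_eq_square algebra_simps)
      then have "3 * (real d - 2) * ?t\<^sup>2 \<le> (real d)\<^sup>2 * (real m)\<^sup>2"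
        using t assms(3) by (intro mult_mono) auto
      also have "\<dots> = (real (m * d))\<^sup>2" by (simp add: power_mult_distrib)
      also have "\<dots> \<le> (real n)\<^sup>2" using md by (intro power_mono of_nat_mono) simp_all
      finally have "3 * (real d - 2) * ?t\<^sup>2 \<le> (real n)\<^sup>2" .
      moreover have "0 < 3 * (real d - 2) * ?t\<^sup>2" proof -
        have "?t \<noteq> 0" using assms(6) by linarith
        then have "0 < ?t\<^sup>2" by (simp only: zero_less_power2 not_False_eq_True)
        then show ?thesis using assms(3) by (intro mult_pos_pos) auto
      qed
      ultimately have x: "1 \<le> ?x" by (simp only: le_divide_eq_1_pos)
      have "1 + ?x \<le> (1 + ?x) ^ (m - 1)"
      proof (rule self_le_power)
        show "1 \<le> 1 + ?x" using x by linarith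
        show "0 < m - 1" using False a by linarith
      qed
      with x show ?thesis by linarith
    qed
    moreover have "1 - (1 + -1) * u * v = 1" for u v :: real by simp
    ultimately show ?thesis by (intro exI[of _ "-1"] conjI) (simp_all only:)
  qed
qed

end
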